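(* Let $(R,\mathbf m)$ be a $d$-dimensional equicharacteristic regular local ring and fix $d$ elements $x, y_2, \ldots, y_d$ with $\mathbf m = (x, y_2, \ldots, y_d)R$. Let $I$ be an $\mathbf m$-primary monomial ideal of $R$ (with respect to $x,y_2,\ldots,y_d$) and let $r = \operatorname{ord}_R(I)$. If $(y_2, \ldots, y_d)^r \subseteq I$ and $I$ is contracted from $S = R[\frac{\mathbf m}{x}]$, then $$\mu(I) = \mu(\mathbf m^r) = \binom{d+r-1}{r}.$$
   Context: A monomial ideal of $R$ (with respect to the fixed minimal generators $x,y_2,\ldots,y_d$ of $\mathbf m$) is an ideal generated by elements $x^{a}y_2^{b_2}\cdots y_d^{b_d}$ with nonnegative integer exponents. $\operatorname{ord}_R(I)$ is the integer $r$ with $I\subseteq \mathbf m^r$ and $I\not\subseteq \mathbf m^{r+1}$. $\mu(I)$ is the minimal number of generators of $I$. $R[\frac{\mathbf m}{x}] = R[\frac{y_2}{x},\ldots,\frac{y_d}{x}]$. The ideal $I$ is contracted from $S$ if $IS\cap R = I$. *)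

theory Defs
  imports "HOL-Algebra.Algebra" "HOL-Library.Extended_Nat"
begin

definition min_gens :: "('a, 'm) ring_scheme \<Rightarrow> 'a set \<Rightarrow> nat" where
  "min_gens R I = (LEAST n. \<exists>A. A \<subseteq> carrier R \<and> finite A \<and> card A = n \<and> genideal R A = I)"

definition krull_dim :: "('a, 'm) ring_scheme \<Rightarrow> enat" where
  "krull_dim R = Sup {enat n | n. \<exists>P :: nat \<Rightarrow> 'a set.
     (\<forall>i\<le>n. primeideal (P i) R) \<and> (\<forall>i<n. P i \<subset> P (Suc i))}"

text \<open>The additive order of the unit element; \<^term>\<open>group.ord\<close> is 0 on elements of
  infinite order, so this gives 0 in characteristic zero.\<close>

definition ring_char :: "('a, 'm) ring_scheme \<Rightarrow> nat" where
  "ring_char R = group.ord (add_monoid R) \<one>\<^bsub>R\<^esub>"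

locale local_ring = cring R for R (structure) and \<mm> +
  assumes maximalideal_iff: "maximalideal M R \<longleftrightarrow> M = \<mm>"

locale regular_local_ring = local_ring R \<mm> + noetherian_ring R for R (structure) and \<mm> +
  assumes regular: "krull_dim R = enat (min_gens R \<mm>)"

definition equicharacteristic :: "('a, 'm) ring_scheme \<Rightarrow> 'a set \<Rightarrow> bool" where
  "equicharacteristic R \<mm> \<longleftrightarrow> ring_char R = ring_char (R Quot \<mm>)"

definition ideal_radical :: "('a, 'm) ring_scheme \<Rightarrow> 'a set \<Rightarrow> 'a set" where
  "ideal_radical R I = {a \<in> carrier R. \<exists>n::nat. a [^]\<^bsub>R\<^esub> n \<in> I}"

locale primary_ideal = ideal I R + cring R for I and R (structure) +
  assumes I_notcarr: "carrier R \<noteq> I"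
    and I_primary: "\<lbrakk>a \<in> carrier R; b \<in> carrier R; a \<otimes> b \<in> I\<rbrakk> \<Longrightarrow> a \<in> I \<or> b \<in> ideal_radical R I"

text \<open>The elements \<open>x^a y_2^(b 2) ... y_d^(b d)\<close>.\<close>

definition monomials :: "('a, 'm) ring_scheme \<Rightarrow> nat \<Rightarrow> 'a \<Rightarrow> (nat \<Rightarrow> 'a) \<Rightarrow> 'a set" where
  "monomials R d x y =
     {x [^]\<^bsub>R\<^esub> a \<otimes>\<^bsub>R\<^esub> finprod R (\<lambda>i. y i [^]\<^bsub>R\<^esub> b i) {2..d} | (a::nat) (b::nat \<Rightarrow> nat). True}"

definition monomial_ideal :: "('a, 'm) ring_scheme \<Rightarrow> nat \<Rightarrow> 'a \<Rightarrow> (nat \<Rightarrow> 'a) \<Rightarrow> 'a set \<Rightarrow> bool" where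
  "monomial_ideal R d x y I \<longleftrightarrow> (\<exists>A \<subseteq> monomials R d x y. I = genideal R A)"

definition nonzerodivisors :: "('a, 'm) ring_scheme \<Rightarrow> 'a set" where
  "nonzerodivisors R =
     {s \<in> carrier R. \<forall>a\<in>carrier R. s \<otimes>\<^bsub>R\<^esub> a = \<zero>\<^bsub>R\<^esub> \<longrightarrow> a = \<zero>\<^bsub>R\<^esub>}"

text \<open>\<open>K\<close>, with the embedding \<open>\<iota>\<close>, is the total ring of fractions of \<open>R\<close>. It exists for every
  commutative ring and is the field of fractions when \<open>R\<close> is a domain (see the lemma below); so
  working inside it does not require assuming separately that a regular local ring is a domain.\<close>

locale fraction_ring = ring_hom_cring R K \<iota> for R (structure) and K (structure) and \<iota> +
  assumes inj: "inj_on \<iota> (carrier R)"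
    and units: "s \<in> nonzerodivisors R \<Longrightarrow> \<iota> s \<in> Units K"
    and fractions: "z \<in> carrier K \<Longrightarrow>
      \<exists>a\<in>carrier R. \<exists>s\<in>nonzerodivisors R. z = \<iota> a \<otimes>\<^bsub>K\<^esub> inv\<^bsub>K\<^esub> (\<iota> s)"

lemma (in fraction_ring) field_of_fractions:
  assumes "domain R"
  shows "field K"
proof -
  interpret D: domain R by fact
  have nz: "s \<in> nonzerodivisors R" if "s \<in> carrier R" "s \<noteq> \<zero>\<^bsub>R\<^esub>" for s
    using that D.integral_iff unfolding nonzerodivisors_def by auto
  have one: "\<one>\<^bsub>K\<^esub> \<noteq> \<zero>\<^bsub>K\<^esub>"
    using inj_onD[OF inj, of "\<one>\<^bsub>R\<^esub>" "\<zero>\<^bsub>R\<^esub>"] D.one_not_zero by auto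
  show ?thesis
  proof (rule S.cring_fieldI2[OF one[symmetric]])
    fix z assume z: "z \<in> carrier K" "z \<noteq> \<zero>\<^bsub>K\<^esub>"
    then obtain a s where as: "a \<in> carrier R" "s \<in> nonzerodivisors R"
      "z = \<iota> a \<otimes>\<^bsub>K\<^esub> inv\<^bsub>K\<^esub> (\<iota> s)" using fractions by blast
    have "a \<noteq> \<zero>\<^bsub>R\<^esub>" using as z units S.Units_inv_closed by auto
    then have "z \<in> Units K"
      using as units[OF nz[OF as(1)]] units[OF as(2)]
      by (simp add: S.Units_m_closed)
    then show "\<exists>b\<in>carrier K. z \<otimes>\<^bsub>K\<^esub> b = \<one>\<^bsub>K\<^esub>" using S.Units_r_inv S.Units_inv_closed by blast
  qed
qed

text \<open>The subring \<open>R[y_2/x, ..., y_d/x]\<close> of \<open>K\<close>.\<close>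

definition blowup_chart ::
  "('a, 'm) ring_scheme \<Rightarrow> ('b, 'n) ring_scheme \<Rightarrow> ('a \<Rightarrow> 'b) \<Rightarrow> nat \<Rightarrow> 'a \<Rightarrow> (nat \<Rightarrow> 'a) \<Rightarrow>
   ('b, 'n) ring_scheme" where
  "blowup_chart R K \<iota> d x y =
     K\<lparr>carrier := generate_ring K
         (\<iota> ` carrier R \<union> (\<lambda>i. \<iota> (y i) \<otimes>\<^bsub>K\<^esub> inv\<^bsub>K\<^esub> (\<iota> x)) ` {2..d})\<rparr>"

definition contracted_from ::
  "('a, 'm) ring_scheme \<Rightarrow> ('b, 'n) ring_scheme \<Rightarrow> ('a \<Rightarrow> 'b) \<Rightarrow> 'a set \<Rightarrow> bool" where
  "contracted_from R S \<iota> I \<longleftrightarrow> {a \<in> carrier R. \<iota> a \<in> genideal S (\<iota> ` I)} = I"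

end

theory Submission
  imports Defs
begin

text \<open>
  Contraction from \<open>S = R[\<mm>/x]\<close> makes the monomial ideal \<open>I\<close> stable: if a monomial of \<open>I\<close> is divisible
  by \<open>x\<close>, then a factor \<open>x\<close> may be replaced by any \<open>y\<^sub>i\<close>, because \<open>y\<^sub>i = x (y\<^sub>i / x)\<close> in \<open>S\<close>
  (\<open>contracted_shift\<close>). For each monomial \<open>y\<^sup>b\<close> of degree at most \<open>r\<close> there is a least exponent \<open>h b\<close>
  with \<open>x\<^sup>(h b) y\<^sup>b\<close> in \<open>I\<close>; it exists since \<open>I\<close> contains a power of \<open>x\<close>. As \<open>(y\<^sub>2, \<dots>, y\<^sub>d)\<^sup>r\<close> lies in
  \<open>I\<close>, these monomials generate \<open>I\<close>. Stability and the inclusion of \<open>I\<close> in \<open>\<mm>\<^sup>r\<close> show that none of them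
  divides another one. So the minimal monomial generators of \<open>I\<close> correspond to the monomials \<open>y\<^sup>b\<close> of
  degree at most \<open>r\<close>, and multiplication by a power of \<open>x\<close> matches those with the monomials of degree
  exactly \<open>r\<close> in all variables, which generate \<open>\<mm>\<^sup>r\<close> (\<open>min_gens_stable_monomial_ideal\<close>).

  It remains to see that monomials in a regular system of parameters behave as in a polynomial ring:
  a monomial \<open>z\<^sup>a\<close> is not in the ideal generated by the monomials that do not divide it. This ideal is
  generated by the powers \<open>(z i)\<^sup>(a i + 1)\<close>, so the claim follows by cancelling the factors of \<open>z\<^sup>a\<close>
  one after the other, as soon as each parameter is a nonzerodivisor modulo powers of the
  others (\<open>parameter_nonzerodivisor\<close>). For first powers this says that any set of parameters
  generates a prime ideal that contains no other parameter. The exchange lemma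
  \<open>independent_card_le\<close> then turns the claim into \<open>min_gens_monomials\<close>: finitely many monomials that do
  not divide each other form a minimal generating set of least cardinality.

  Primality comes from the dimension. By Krull's principal ideal theorem a chain of primes can be made
  to pass through a given element of its top at the cost of one step (\<open>prime_chain_through\<close>). A regular
  local ring has a chain with as many steps as there are parameters. Passing through the parameters
  in any order, no further step can be lost, and this forces the first member of the chain to be the
  ideal generated by the parameters treated so far (\<open>chain_start_unique\<close>).

  The principal ideal theorem is a statement about the localisation at a prime \<open>Q\<close>. It is proved
  here with ideals of \<open>R\<close> that are saturated with respect to the complement of \<open>Q\<close>.
\<close>

section \<open>Ideals, element by element\<close>

context ring
begin

lemma ideal_add: "ideal J R \<Longrightarrow> a \<in> J \<Longrightarrow> b \<in> J \<Longrightarrow> a \<oplus> b \<in> J"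
  by (simp add: additive_subgroup.a_closed ideal.axioms(1))

lemma ideal_minus: "ideal J R \<Longrightarrow> a \<in> J \<Longrightarrow> b \<in> J \<Longrightarrow> a \<ominus> b \<in> J"
  by (simp add: a_minus_def additive_subgroup.a_closed additive_subgroup.a_inv_closed ideal.axioms(1))

lemma ideal_zero: "ideal J R \<Longrightarrow> \<zero> \<in> J"
  by (simp add: additive_subgroup.zero_closed ideal.axioms(1))

lemma ideal_prod_Suc_pow:
  "P [^]\<^bsub>ideals_set R\<^esub> Suc n = (P [^]\<^bsub>ideals_set R\<^esub> n) \<cdot> P"
  by (simp add: nat_pow_def ideals_set_def)

lemma ideal_pow: "ideal P R \<Longrightarrow> ideal (P [^]\<^bsub>ideals_set R\<^esub> (n::nat)) R"
proof (induction n)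
  case 0
  show ?case using oneideal by (simp add: nat_pow_def ideals_set_def)
next
  case (Suc n)
  then show ?case by (simp only: ideal_prod_Suc_pow ideal_prod_is_ideal)
qed

end

context cring
begin

lemma cring_idealI:
  assumes "J \<subseteq> carrier R" "\<zero> \<in> J"
    and "\<And>a b. a \<in> J \<Longrightarrow> b \<in> J \<Longrightarrow> a \<oplus> b \<in> J"
    and "\<And>a c. a \<in> J \<Longrightarrow> c \<in> carrier R \<Longrightarrow> c \<otimes> a \<in> J"
  shows "ideal J R"
proof (rule idealI)
  show "subgroup J (add_monoid R)"
  proof
    fix a assume a: "a \<in> J"
    have "inv\<^bsub>add_monoid R\<^esub> a = (\<ominus> \<one>) \<otimes> a"
      using a assms(1) by (metis a_inv_def l_minus l_one one_closed subsetD)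
    then show "inv\<^bsub>add_monoid R\<^esub> a \<in> J" using assms(4)[OF a] by simp
  qed (use assms in auto)
next
  fix a c assume "a \<in> J" "c \<in> carrier R"
  then show "a \<otimes> c \<in> J" using assms(4)[of a c] assms(1) m_comm[of a c] by auto
qed (use assms in \<open>auto intro: ring_axioms\<close>)

text \<open>The ideal \<open>Qa + J\<close>. With \<open>Q\<close> the whole ring it describes the ideal obtained from \<open>J\<close> by
  adjoining \<open>a\<close>; with \<open>Q\<close> a proper ideal it splits off one generator in Nakayama's lemma.\<close>

lemma ideal_mult_add:
  assumes Q: "ideal Q R" and J: "ideal J R" and a: "a \<in> carrier R"
  shows "ideal {q \<otimes> a \<oplus> v | q v. q \<in> Q \<and> v \<in> J} R"
proof (rule cring_idealI)
  show "{q \<otimes> a \<oplus> v | q v. q \<in> Q \<and> v \<in> J} \<subseteq> carrier R"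
    using a ideal.Icarr[OF Q] ideal.Icarr[OF J] by auto
  have "\<zero> = \<zero> \<otimes> a \<oplus> \<zero>" using a by simp
  then show "\<zero> \<in> {q \<otimes> a \<oplus> v | q v. q \<in> Q \<and> v \<in> J}"
    using ideal_zero[OF Q] ideal_zero[OF J] by blast
next
  fix b c assume "b \<in> {q \<otimes> a \<oplus> v | q v. q \<in> Q \<and> v \<in> J}" "c \<in> {q \<otimes> a \<oplus> v | q v. q \<in> Q \<and> v \<in> J}"
  then obtain q v q' v' where *: "q \<in> Q" "v \<in> J" "q' \<in> Q" "v' \<in> J"
    "b = q \<otimes> a \<oplus> v" "c = q' \<otimes> a \<oplus> v'" by blast
  have cc: "q \<in> carrier R" "v \<in> carrier R" "q' \<in> carrier R" "v' \<in> carrier R"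
    using * ideal.Icarr[OF Q] ideal.Icarr[OF J] by auto
  have "b \<oplus> c = (q \<oplus> q') \<otimes> a \<oplus> (v \<oplus> v')"
    unfolding *(5,6) using cc a by algebra
  then show "b \<oplus> c \<in> {q \<otimes> a \<oplus> v | q v. q \<in> Q \<and> v \<in> J}"
    using ideal_add[OF Q *(1,3)] ideal_add[OF J *(2,4)] by blast
next
  fix b c assume "b \<in> {q \<otimes> a \<oplus> v | q v. q \<in> Q \<and> v \<in> J}" and c: "c \<in> carrier R"
  then obtain q v where *: "q \<in> Q" "v \<in> J" "b = q \<otimes> a \<oplus> v" by blast
  have cc: "q \<in> carrier R" "v \<in> carrier R"
    using * ideal.Icarr[OF Q] ideal.Icarr[OF J] by auto
  have "c \<otimes> b = (c \<otimes> q) \<otimes> a \<oplus> (c \<otimes> v)"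
    unfolding * using cc a c by algebra
  then show "c \<otimes> b \<in> {q \<otimes> a \<oplus> v | q v. q \<in> Q \<and> v \<in> J}"
    using ideal.I_l_closed[OF Q *(1) c] ideal.I_l_closed[OF J *(2) c] by blast
qed

lemma Idl_insert:
  assumes a: "a \<in> carrier R" and S: "S \<subseteq> carrier R"
  shows "Idl (insert a S) = {q \<otimes> a \<oplus> v | q v. q \<in> carrier R \<and> v \<in> Idl S}" (is "_ = ?M")
proof
  have IS: "ideal (Idl S) R" using S by (rule genideal_ideal)
  have "a = \<one> \<otimes> a \<oplus> \<zero>" using a by simp
  then have "a \<in> ?M" using ideal_zero[OF IS] by blast
  moreover have "S \<subseteq> ?M"
  proof
    fix s assume s: "s \<in> S"
    then have "s = \<zero> \<otimes> a \<oplus> s" using a S by auto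
    then show "s \<in> ?M" using s genideal_self[OF S] by blast
  qed
  ultimately show "Idl (insert a S) \<subseteq> ?M"
    using genideal_minimal[OF ideal_mult_add[OF oneideal IS a]] by blast
  have I: "ideal (Idl (insert a S)) R" using a S by (intro genideal_ideal) auto
  have "a \<in> Idl (insert a S)" "Idl S \<subseteq> Idl (insert a S)"
    using a S genideal_self[of "insert a S"] subset_Idl_subset[of "insert a S" S] by auto
  then show "?M \<subseteq> Idl (insert a S)"
    using ideal_add[OF I] ideal.I_l_closed[OF I] by blast
qed

lemma Idl_insertE:
  assumes "w \<in> Idl (insert a S)" "a \<in> carrier R" "S \<subseteq> carrier R"
  obtains q v where "q \<in> carrier R" "v \<in> Idl S" "w = q \<otimes> a \<oplus> v"
  using assms Idl_insert by blast

lemma Idl_ideal: "ideal J R \<Longrightarrow> Idl J = J"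
  by (meson Idl_subset_ideal equalityI genideal_self ideal.Icarr order_refl subsetI)

lemma colon_ideal: "ideal J R \<Longrightarrow> a \<in> carrier R \<Longrightarrow> ideal {w \<in> carrier R. a \<otimes> w \<in> J} R"
  by (rule ideal.helper_max_prime) (auto intro: cring_axioms)

lemma mult_Idl_subset:
  assumes "ideal J R" "a \<in> carrier R" "S \<subseteq> carrier R" "\<And>s. s \<in> S \<Longrightarrow> a \<otimes> s \<in> J"
    and "w \<in> Idl S"
  shows "a \<otimes> w \<in> J"
proof -
  have "Idl S \<subseteq> {w \<in> carrier R. a \<otimes> w \<in> J}"
    using assms by (intro genideal_minimal colon_ideal) auto
  then show ?thesis using assms(5) by blast
qed

end

locale noetherian_cring = cring R + noetherian_ring R for R (structure)

context noetherian_cring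
begin

lemma exists_maximal_ideal_in:
  assumes "F \<noteq> {}" "\<And>J. J \<in> F \<Longrightarrow> ideal J R"
  shows "\<exists>M\<in>F. \<forall>B\<in>F. M \<subseteq> B \<longrightarrow> B = M"
proof (rule subset_Zorn_nonempty[OF assms(1)])
  fix C assume C: "C \<noteq> {}" "subset.chain F C"
  have CF: "C \<subseteq> F" using C(2) by (rule subset.chain_def[THEN iffD1, THEN conjunct1])
  then have "C \<subseteq> {I. ideal I R}" using assms(2) by auto
  then have "subset.chain {I. ideal I R} C" using C(2) by (simp add: subset.chain_def)
  then have "\<Union>C \<in> C" by (rule ideal_chain_is_trivial[OF C(1)])
  then show "\<Union>C \<in> F" using CF by (rule rev_subsetD)
qed

section \<open>Nakayama's lemma at a prime\<close>

text \<open>The generators are eliminated one by one. The relation for a generator \<open>c\<close> reads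
  \<open>(s - q) c = v\<close> with \<open>s - q\<close> outside \<open>Q\<close>, where \<open>v\<close> lies in \<open>L\<close> up to multiples of the other generators.
  After multiplication by \<open>s - q\<close> the other relations no longer mention \<open>c\<close>.\<close>

lemma nakayama_generators:
  assumes Q: "primeideal Q R" and L: "ideal L R" and "finite A" and "A \<subseteq> carrier R"
    and "\<And>a. a \<in> A \<Longrightarrow> \<exists>s\<in>carrier R - Q. s \<otimes> a \<in> Idl (L \<union> {q \<otimes> b | q b. q \<in> Q \<and> b \<in> A})"
  shows "\<exists>t\<in>carrier R - Q. \<forall>a\<in>A. t \<otimes> a \<in> L"
  using assms(3-5)
proof (induction A rule: finite_induct)
  case empty
  have "\<one> \<in> carrier R - Q"
    using Q primeideal.I_notcarr[OF Q] ideal.one_imp_carrier[OF primeideal.axioms(1)[OF Q]] by auto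
  then show ?case by blast
next
  case (insert c A)
  have IQ: "ideal Q R" using Q by (rule primeideal.axioms)
  have Lc: "L \<subseteq> carrier R" using ideal.Icarr[OF L] by blast
  have Qc: "Q \<subseteq> carrier R" using ideal.Icarr[OF IQ] by blast
  have c: "c \<in> carrier R" and A: "A \<subseteq> carrier R" using insert.prems by auto
  define J where "J = Idl (L \<union> {q \<otimes> b | q b. q \<in> Q \<and> b \<in> A})"
  have gc: "L \<union> {q \<otimes> b | q b. q \<in> Q \<and> b \<in> A} \<subseteq> carrier R" using Lc Qc A by auto
  have J: "ideal J R" unfolding J_def using gc by (rule genideal_ideal)
  have LJ: "L \<union> {q \<otimes> b | q b. q \<in> Q \<and> b \<in> A} \<subseteq> J" unfolding J_def using gc by (rule genideal_self)
  have split: "\<exists>q v. q \<in> Q \<and> v \<in> J \<and> w = q \<otimes> c \<oplus> v"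
    if "w \<in> Idl (L \<union> {q \<otimes> b | q b. q \<in> Q \<and> b \<in> insert c A})" for w
  proof -
    have "Idl (L \<union> {q \<otimes> b | q b. q \<in> Q \<and> b \<in> insert c A}) \<subseteq> {q \<otimes> c \<oplus> v | q v. q \<in> Q \<and> v \<in> J}"
    proof (rule genideal_minimal[OF ideal_mult_add[OF IQ J c]], rule subsetI)
      fix w assume w: "w \<in> L \<union> {q \<otimes> b | q b. q \<in> Q \<and> b \<in> insert c A}"
      show "w \<in> {q \<otimes> c \<oplus> v | q v. q \<in> Q \<and> v \<in> J}"
      proof (cases "w \<in> J")
        case True
        then have "w = \<zero> \<otimes> c \<oplus> w" using c ideal.Icarr[OF J] by auto
        then show ?thesis using True ideal_zero[OF IQ] by blast
      next
        case False
        then obtain q where "q \<in> Q" "w = q \<otimes> c" using w LJ by blast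
        then have "w = q \<otimes> c \<oplus> \<zero>" using c Qc by auto
        then show ?thesis using \<open>q \<in> Q\<close> ideal_zero[OF J] by blast
      qed
    qed
    then show ?thesis using that by blast
  qed
  obtain s q v where s: "s \<in> carrier R" "s \<notin> Q" and q: "q \<in> Q" and v: "v \<in> J"
    and sc: "s \<otimes> c = q \<otimes> c \<oplus> v" using insert.prems(2)[of c] split by blast
  have qc: "q \<in> carrier R" and vc: "v \<in> carrier R" using q Qc v ideal.Icarr[OF J] by auto
  \<comment> \<open>The relation for \<open>c\<close> is solved for \<open>c\<close>: its coefficient \<open>t\<close> is still outside \<open>Q\<close>.\<close>
  define t where "t = s \<ominus> q"
  have t: "t \<in> carrier R" unfolding t_def using s qc by simp
  have "s = t \<oplus> q" unfolding t_def using s qc by algebra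
  then have tQ: "t \<notin> Q" using s q ideal_add[OF IQ] by auto
  have "t \<otimes> c = s \<otimes> c \<ominus> q \<otimes> c" unfolding t_def using s qc c by algebra
  also have "\<dots> = v" unfolding sc using qc c vc by algebra
  finally have tc: "t \<otimes> c = v" .
  have "\<exists>s\<in>carrier R - Q. s \<otimes> a \<in> J" if a: "a \<in> A" for a
  proof -
    obtain s' q' v' where s': "s' \<in> carrier R" "s' \<notin> Q" and q': "q' \<in> Q" and v': "v' \<in> J"
      and sa: "s' \<otimes> a = q' \<otimes> c \<oplus> v'" using insert.prems(2)[of a] split a by blast
    have cc: "q' \<in> carrier R" "v' \<in> carrier R" "a \<in> carrier R"
      using q' Qc v' ideal.Icarr[OF J] a A by auto
    have "(t \<otimes> s') \<otimes> a = t \<otimes> (s' \<otimes> a)" using t s' cc by algebra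
    also have "\<dots> = q' \<otimes> (t \<otimes> c) \<oplus> t \<otimes> v'" unfolding sa using t s' cc c by algebra
    also have "\<dots> \<in> J" unfolding tc
      using ideal_add[OF J] ideal.I_l_closed[OF J] v v' cc t by auto
    finally have "(t \<otimes> s') \<otimes> a \<in> J" .
    moreover have "t \<otimes> s' \<in> carrier R - Q"
      using t s' tQ primeideal.I_prime[OF Q] by auto
    ultimately show ?thesis by blast
  qed
  then obtain t' where t': "t' \<in> carrier R" "t' \<notin> Q" "\<forall>a\<in>A. t' \<otimes> a \<in> L"
    using insert.IH[OF A] unfolding J_def by blast
  have "t' \<otimes> v \<in> L"
  proof (rule mult_Idl_subset[OF L t'(1) gc _ v[unfolded J_def]])
    fix w assume "w \<in> L \<union> {q \<otimes> b |q b. q \<in> Q \<and> b \<in> A}"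
    then consider "w \<in> L" | q b where "w = q \<otimes> b" "q \<in> Q" "b \<in> A" by blast
    then show "t' \<otimes> w \<in> L"
    proof cases
      case 2
      then have "t' \<otimes> w = q \<otimes> (t' \<otimes> b)" using t' A Qc by (simp add: m_lcomm subset_iff)
      then show ?thesis using 2 t' ideal.I_l_closed[OF L] Qc by auto
    qed (use t' ideal.I_l_closed[OF L] in auto)
  qed
  then have "t' \<otimes> t \<otimes> c \<in> L" using tc t t' c by (simp add: m_assoc)
  moreover have "t' \<otimes> t \<otimes> a \<in> L" if "a \<in> A" for a
  proof -
    have "t' \<otimes> t \<otimes> a = t \<otimes> (t' \<otimes> a)" using t t' that A by (simp add: m_ac subset_iff)
    then show ?thesis using that t' t ideal.I_l_closed[OF L] by auto
  qed
  moreover have "t' \<otimes> t \<in> carrier R - Q" using t t' tQ primeideal.I_prime[OF Q] by auto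
  ultimately show ?case by blast
qed

text \<open>This is Nakayama's lemma for the localisation at \<open>Q\<close>: if \<open>N\<close> is contained in \<open>L + NQ\<close> locally
  at \<open>Q\<close>, then it is contained in \<open>L\<close> locally at \<open>Q\<close>. The denominators are written out, so that the
  localised ring need not be constructed.\<close>

lemma nakayama_at_prime:
  assumes Q: "primeideal Q R" and L: "ideal L R" and N: "ideal N R"
    and *: "\<And>a. a \<in> N \<Longrightarrow> \<exists>s\<in>carrier R - Q. \<exists>l\<in>L. \<exists>v\<in>N \<cdot> Q. s \<otimes> a = l \<oplus> v"
  obtains t where "t \<in> carrier R - Q" "\<And>a. a \<in> N \<Longrightarrow> t \<otimes> a \<in> L"
proof -
  obtain A where A: "A \<subseteq> carrier R" "finite A" "N = Idl A" using finetely_gen[OF N] by blast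
  have IQ: "ideal Q R" using Q by (rule primeideal.axioms)
  have Qc: "Q \<subseteq> carrier R" using ideal.Icarr[OF IQ] by blast
  define G where "G = L \<union> {q \<otimes> b | q b. q \<in> Q \<and> b \<in> A}"
  have Gc: "G \<subseteq> carrier R" unfolding G_def using ideal.Icarr[OF L] Qc A by auto
  have IG: "ideal (Idl G) R" using Gc by (rule genideal_ideal)
  have GG: "G \<subseteq> Idl G" using Gc by (rule genideal_self)
  have NQ: "v \<in> Idl G" if "v \<in> N \<cdot> Q" for v
    using that
  proof (induction rule: ideal_prod.induct)
    case (prod i j)
    have jc: "j \<in> carrier R" using prod(2) Qc by blast
    have "j \<otimes> i \<in> Idl G"
    proof (rule mult_Idl_subset[OF IG jc A(1)])
      fix b assume "b \<in> A"
      then have "j \<otimes> b \<in> G" using prod(2) unfolding G_def by blast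
      then show "j \<otimes> b \<in> Idl G" using GG by blast
    qed (use prod(1) A(3) in blast)
    then show ?case using prod Qc ideal.Icarr[OF N] m_comm by auto
  qed (rule ideal_add[OF IG])
  have "\<exists>t\<in>carrier R - Q. \<forall>a\<in>A. t \<otimes> a \<in> L"
  proof (rule nakayama_generators[OF Q L A(2,1)])
    fix a assume "a \<in> A"
    then have "a \<in> N" using A genideal_self by auto
    then obtain s l v where s: "s \<in> carrier R - Q" "l \<in> L" "v \<in> N \<cdot> Q" "s \<otimes> a = l \<oplus> v"
      using * by blast
    have "l \<in> Idl G" using s(2) GG by (auto simp: G_def)
    then have "s \<otimes> a \<in> Idl G" unfolding s(4) using NQ[OF s(3)] by (rule ideal_add[OF IG])
    then show "\<exists>s\<in>carrier R - Q. s \<otimes> a \<in> Idl (L \<union> {q \<otimes> b |q b. q \<in> Q \<and> b \<in> A})"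
      using s(1) unfolding G_def by blast
  qed
  then obtain t where t: "t \<in> carrier R - Q" "\<forall>a\<in>A. t \<otimes> a \<in> L" by blast
  show thesis
  proof (rule that[OF t(1)])
    fix a assume "a \<in> N"
    then show "t \<otimes> a \<in> L" using t A(3) by (rule_tac mult_Idl_subset[OF L _ A(1)]) blast+
  qed
qed

end

section \<open>Saturation with respect to a prime\<close>

text \<open>The contraction to \<open>R\<close> of the extension of \<open>B\<close> to the localisation at \<open>Q\<close>. Saturated ideals
  stand for the ideals of the localised ring.\<close>

definition saturation :: "('a, 'm) ring_scheme \<Rightarrow> 'a set \<Rightarrow> 'a set \<Rightarrow> 'a set" where
  "saturation R Q B = {w \<in> carrier R. \<exists>s\<in>carrier R - Q. s \<otimes>\<^bsub>R\<^esub> w \<in> B}"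

context cring
begin

lemma prime_one: "primeideal Q R \<Longrightarrow> \<one> \<in> carrier R - Q"
  using primeideal.I_notcarr ideal.one_imp_carrier primeideal.axioms(1) by fastforce

lemma prime_mult_notin:
  "primeideal Q R \<Longrightarrow> s \<in> carrier R - Q \<Longrightarrow> t \<in> carrier R - Q \<Longrightarrow> s \<otimes> t \<in> carrier R - Q"
  using primeideal.I_prime by fastforce

lemma prime_pow_notin:
  "primeideal P R \<Longrightarrow> p \<in> carrier R - P \<Longrightarrow> p [^] (n::nat) \<in> carrier R - P"
proof (induction n)
  case 0
  then show ?case using prime_one by simp
next
  case (Suc n)
  then show ?case using prime_mult_notin[of P "p [^] n" p] by simp
qed

lemma pow_mem_ideal_pow:
  "p \<in> P \<Longrightarrow> P \<subseteq> carrier R \<Longrightarrow> p [^] (n::nat) \<in> P [^]\<^bsub>ideals_set R\<^esub> n"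
proof (induction n)
  case 0
  then show ?case by (auto simp: nat_pow_def ideals_set_def)
next
  case (Suc n)
  then show ?case unfolding ideal_prod_Suc_pow by (auto intro: ideal_prod.prod)
qed

lemma saturation_ideal:
  assumes Q: "primeideal Q R" and B: "ideal B R"
  shows "ideal (saturation R Q B) R"
proof (rule cring_idealI)
  show "saturation R Q B \<subseteq> carrier R" unfolding saturation_def by blast
  have "\<one> \<otimes> \<zero> \<in> B" using ideal_zero[OF B] by simp
  then show "\<zero> \<in> saturation R Q B" using prime_one[OF Q] unfolding saturation_def by blast
next
  fix a b assume "a \<in> saturation R Q B" "b \<in> saturation R Q B"
  then obtain s t where *: "a \<in> carrier R" "b \<in> carrier R" "s \<in> carrier R - Q" "t \<in> carrier R - Q"
    "s \<otimes> a \<in> B" "t \<otimes> b \<in> B" unfolding saturation_def by blast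
  have "(s \<otimes> t) \<otimes> (a \<oplus> b) = t \<otimes> (s \<otimes> a) \<oplus> s \<otimes> (t \<otimes> b)"
    using * by (auto simp: r_distr m_ac)
  also have "\<dots> \<in> B"
    using ideal_add[OF B] ideal.I_l_closed[OF B *(5)] ideal.I_l_closed[OF B *(6)] *(3,4) by blast
  finally show "a \<oplus> b \<in> saturation R Q B"
    using prime_mult_notin[OF Q *(3,4)] * unfolding saturation_def by blast
next
  fix a c assume "a \<in> saturation R Q B" and c: "c \<in> carrier R"
  then obtain s where *: "a \<in> carrier R" "s \<in> carrier R - Q" "s \<otimes> a \<in> B"
    unfolding saturation_def by blast
  have "s \<otimes> (c \<otimes> a) = c \<otimes> (s \<otimes> a)" using * c by (auto simp: m_ac)
  also have "\<dots> \<in> B" using ideal.I_l_closed[OF B *(3) c] .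
  finally show "c \<otimes> a \<in> saturation R Q B" using * c unfolding saturation_def by blast
qed

lemma saturation_increasing:
  assumes "primeideal Q R" "B \<subseteq> carrier R"
  shows "B \<subseteq> saturation R Q B"
proof
  fix b assume "b \<in> B"
  then have "\<one> \<otimes> b \<in> B" "b \<in> carrier R" using assms by auto
  then show "b \<in> saturation R Q B" using prime_one[OF assms(1)] unfolding saturation_def by blast
qed

lemma saturation_mono: "B \<subseteq> C \<Longrightarrow> saturation R Q B \<subseteq> saturation R Q C"
  unfolding saturation_def by blast

lemma saturation_idem:
  assumes Q: "primeideal Q R"
  shows "saturation R Q (saturation R Q B) \<subseteq> saturation R Q B"
proof
  fix w assume "w \<in> saturation R Q (saturation R Q B)"
  then obtain s t where *: "w \<in> carrier R" "s \<in> carrier R - Q" "t \<in> carrier R - Q" "t \<otimes> (s \<otimes> w) \<in> B"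
    unfolding saturation_def by blast
  then have "(t \<otimes> s) \<otimes> w \<in> B" by (simp add: m_assoc)
  then show "w \<in> saturation R Q B"
    using * prime_mult_notin[OF Q *(3,2)] unfolding saturation_def by blast
qed

lemma saturatedD:
  "saturation R Q B \<subseteq> B \<Longrightarrow> s \<in> carrier R - Q \<Longrightarrow> w \<in> carrier R \<Longrightarrow> s \<otimes> w \<in> B \<Longrightarrow> w \<in> B"
  unfolding saturation_def by blast

end

context noetherian_cring
begin

text \<open>Among the colon ideals \<open>(B : a)\<close> with \<open>a\<close> outside \<open>B\<close>, a maximal one is prime: if
  \<open>v\<close> is not in \<open>(B : a)\<close>, then \<open>(B : av)\<close> contains \<open>(B : a)\<close>, hence equals it, and
  \<open>uv\<close> in \<open>(B : a)\<close> means \<open>u\<close> in \<open>(B : av)\<close>.\<close>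

lemma exists_associated_prime:
  assumes B: "ideal B R" and "B \<noteq> carrier R"
  obtains a where "a \<in> carrier R" "a \<notin> B" "primeideal {w \<in> carrier R. a \<otimes> w \<in> B} R"
proof -
  define F where "F = (\<lambda>a. {w \<in> carrier R. a \<otimes> w \<in> B}) ` (carrier R - B)"
  have "F \<noteq> {}" using assms ideal.Icarr[OF B] unfolding F_def by blast
  moreover have "ideal C R" if "C \<in> F" for C using that colon_ideal[OF B] unfolding F_def by auto
  ultimately have "\<exists>M\<in>F. \<forall>C\<in>F. M \<subseteq> C \<longrightarrow> C = M" by (rule exists_maximal_ideal_in)
  then obtain M where M: "M \<in> F" "\<And>C. C \<in> F \<Longrightarrow> M \<subseteq> C \<Longrightarrow> C = M" by blast
  then obtain a where a: "a \<in> carrier R" "a \<notin> B" "M = {w \<in> carrier R. a \<otimes> w \<in> B}"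
    unfolding F_def by blast
  have "primeideal M R"
  proof (rule primeidealI)
    show "ideal M R" using colon_ideal[OF B a(1)] a(3) by simp
    show "cring R" by (rule cring_axioms)
    have "\<one> \<notin> M" using a by simp
    then show "carrier R \<noteq> M" by blast
    fix u v assume uv: "u \<in> carrier R" "v \<in> carrier R" "u \<otimes> v \<in> M"
    show "u \<in> M \<or> v \<in> M"
    proof (rule disjCI)
      assume v: "v \<notin> M"
      define C where "C = {w \<in> carrier R. (a \<otimes> v) \<otimes> w \<in> B}"
      have "a \<otimes> v \<in> carrier R - B" using v a uv by auto
      then have "C \<in> F" unfolding F_def C_def by blast
      moreover have "M \<subseteq> C"
      proof
        fix w assume "w \<in> M"
        then have w: "w \<in> carrier R" "a \<otimes> w \<in> B" using a(3) by auto
        have "(a \<otimes> v) \<otimes> w = v \<otimes> (a \<otimes> w)" using w uv a by (simp add: m_ac)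
        then show "w \<in> C" using w uv ideal.I_l_closed[OF B] unfolding C_def by auto
      qed
      ultimately have "C = M" by (rule M(2))
      moreover have "(a \<otimes> v) \<otimes> u = a \<otimes> (u \<otimes> v)" using uv a by (simp add: m_ac)
      then have "u \<in> C" using uv a(3) unfolding C_def by simp
      ultimately show "u \<in> M" by simp
    qed
  qed
  then show thesis using that a by blast
qed

text \<open>Because \<open>Qa\<close> lies in \<open>M\<close>, the ideal \<open>M + Ra\<close> is simple over \<open>M\<close> locally at \<open>Q\<close>. So each \<open>C n\<close>
  either contains \<open>a\<close> or meets \<open>M + Ra\<close> only in \<open>M\<close>, and in either case it is controlled by
  \<open>C n + Ra\<close>.\<close>

lemma saturated_dcc_step:
  assumes Q: "primeideal Q R" and M: "ideal M R" "saturation R Q M \<subseteq> M"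
    and a: "a \<in> carrier R" "a \<notin> M" "\<And>q. q \<in> Q \<Longrightarrow> q \<otimes> a \<in> M"
    and C: "\<And>n::nat. ideal (C n) R" "\<And>n. saturation R Q (C n) \<subseteq> C n" "\<And>n. M \<subseteq> C n"
      "\<And>i j. i \<le> j \<Longrightarrow> C j \<subseteq> C i"
    and stable: "\<And>k. k \<ge> n \<Longrightarrow>
      saturation R Q (Idl (insert a (C k))) = saturation R Q (Idl (insert a (C n)))"
  shows "\<exists>n. \<forall>k\<ge>n. C k = C n"
proof (cases "\<forall>n. a \<in> C n")
  case True
  have "C k = saturation R Q (Idl (insert a (C k)))" for k
  proof -
    have "Idl (insert a (C k)) = C k" using True Idl_ideal[OF C(1)] by (simp add: insert_absorb)
    moreover have "C k \<subseteq> saturation R Q (C k)"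
      using ideal.Icarr[OF C(1)] by (intro saturation_increasing[OF Q] subsetI)
    ultimately show ?thesis using C(2)[of k] by simp
  qed
  then show ?thesis using stable by (intro exI[of _ n]) metis
next
  case False
  then obtain n1 where n1: "a \<notin> C n1" by blast
  define n2 where "n2 = max n n1"
  have "C n2 \<subseteq> C k" if k: "k \<ge> n2" for k
  proof
    fix w assume w: "w \<in> C n2"
    have wc: "w \<in> carrier R" using w ideal.Icarr[OF C(1)] by blast
    have ck: "C j \<subseteq> carrier R" for j using ideal.Icarr[OF C(1)] by blast
    have "C n2 \<subseteq> Idl (insert a (C n2))" using genideal_self[of "insert a (C n2)"] ck a(1) by simp
    moreover have "Idl (insert a (C n2)) \<subseteq> carrier R"
      using genideal_ideal[of "insert a (C n2)"] ck a(1) ideal.Icarr by (metis insert_subset subsetI)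
    ultimately have "w \<in> saturation R Q (Idl (insert a (C n2)))"
      using saturation_increasing[OF Q, of "Idl (insert a (C n2))"] w by (meson subsetD)
    also have "\<dots> = saturation R Q (Idl (insert a (C k)))"
      using stable[of n2] stable[of k] k unfolding n2_def by simp
    finally obtain s where s: "s \<in> carrier R - Q" "s \<otimes> w \<in> Idl (insert a (C k))"
      unfolding saturation_def by blast
    obtain r c where rc: "r \<in> carrier R" "c \<in> Idl (C k)" "s \<otimes> w = r \<otimes> a \<oplus> c"
      using Idl_insertE[OF s(2) a(1) ck] by blast
    have c: "c \<in> C k" using rc(2) Idl_ideal[OF C(1)] by simp
    have cc: "c \<in> carrier R" using c ck by blast
    have "r \<in> Q"
    proof (rule ccontr)
      assume r: "r \<notin> Q"
      have "r \<otimes> a = s \<otimes> w \<ominus> c" unfolding rc(3) using rc(1) a(1) cc by algebra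
      also have "\<dots> \<in> C n2"
        using ideal_minus[OF C(1)] ideal.I_l_closed[OF C(1) w] s(1) c C(4)[OF k] by blast
      finally have "a \<in> C n2" using saturatedD[OF C(2)] r rc(1) a(1) by blast
      then show False using n1 C(4)[of n1 n2] unfolding n2_def by auto
    qed
    then have "r \<otimes> a \<in> C k" using a(3) C(3) by blast
    then have "s \<otimes> w \<in> C k" unfolding rc(3) using c by (rule ideal_add[OF C(1)])
    then show "w \<in> C k" using saturatedD[OF C(2) s(1) wc] by blast
  qed
  then show ?thesis using C(4) by (intro exI[of _ n2]) blast
qed

text \<open>If \<open>Q\<close> is the only prime between \<open>J\<close> and \<open>Q\<close>, then the ring localised at \<open>Q\<close> and divided
  by \<open>J\<close> is Artinian. In terms of \<open>R\<close> alone: \<open>Q\<close>-saturated ideals above \<open>J\<close> satisfy the descending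
  chain condition. By Noetherian induction one may add to the lower bound an element \<open>a\<close> that spans
  a simple module at \<open>Q\<close>; such an \<open>a\<close> exists because an associated prime of a saturated ideal lies
  between \<open>J\<close> and \<open>Q\<close>, hence is \<open>Q\<close>.\<close>

lemma saturated_dcc:
  assumes Q: "primeideal Q R" and J: "ideal J R"
    and only: "\<And>P. primeideal P R \<Longrightarrow> J \<subseteq> P \<Longrightarrow> P \<subseteq> Q \<Longrightarrow> P = Q"
    and C: "\<And>n::nat. ideal (C n) R" "\<And>n. saturation R Q (C n) \<subseteq> C n" "\<And>n. J \<subseteq> C n"
      "\<And>i j. i \<le> j \<Longrightarrow> C j \<subseteq> C i"
  shows "\<exists>n. \<forall>k\<ge>n. C k = C n"
proof (rule ccontr)
  define bad where "bad B D \<longleftrightarrow> (\<forall>n. ideal (D n) R \<and> saturation R Q (D n) \<subseteq> D n \<and> B \<subseteq> D n) \<and>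
    (\<forall>i j. i \<le> j \<longrightarrow> D j \<subseteq> D i) \<and> \<not> (\<exists>n. \<forall>k\<ge>n. D k = D n)" for B and D :: "nat \<Rightarrow> 'a set"
  define F where "F = {B. ideal B R \<and> saturation R Q B \<subseteq> B \<and> J \<subseteq> B \<and> (\<exists>D. bad B D)}"
  assume n: "\<not> ?thesis"
  define J' where "J' = saturation R Q J"
  have sub: "saturation R Q J \<subseteq> C n" for n using saturation_mono[OF C(3)] C(2) by blast
  have "bad J' C" unfolding bad_def J'_def using C n sub by blast
  then have "J' \<in> F" unfolding F_def
    using saturation_ideal[OF Q J] saturation_idem[OF Q] saturation_increasing[OF Q, of J] ideal.Icarr[OF J]
    unfolding J'_def by blast
  then have "F \<noteq> {}" by blast
  moreover have "ideal B R" if "B \<in> F" for B using that unfolding F_def by simp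
  ultimately have "\<exists>M\<in>F. \<forall>B\<in>F. M \<subseteq> B \<longrightarrow> B = M" by (rule exists_maximal_ideal_in)
  then obtain M where M: "M \<in> F" and Mmax: "\<And>B. B \<in> F \<Longrightarrow> M \<subseteq> B \<Longrightarrow> B = M" by blast
  have IM: "ideal M R" "saturation R Q M \<subseteq> M" "J \<subseteq> M" using M unfolding F_def by auto
  obtain D where bad: "bad M D" using M unfolding F_def by blast
  then have D: "\<And>n. ideal (D n) R" "\<And>n. saturation R Q (D n) \<subseteq> D n" "\<And>n. M \<subseteq> D n"
    "\<And>i j. i \<le> j \<Longrightarrow> D j \<subseteq> D i" and nstab: "\<not> (\<exists>n. \<forall>k\<ge>n. D k = D n)"
    unfolding bad_def by simp_all
  have Dc: "D n \<subseteq> carrier R" for n using ideal.Icarr[OF D(1)] by blast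
  have "M \<noteq> carrier R"
  proof
    assume "M = carrier R"
    then have "D k = D 0" for k using D(3) Dc by (metis subset_antisym)
    then show False using nstab by blast
  qed
  then obtain a where a: "a \<in> carrier R" "a \<notin> M" "primeideal {w \<in> carrier R. a \<otimes> w \<in> M} R"
    by (rule exists_associated_prime[OF IM(1)])
  have "{w \<in> carrier R. a \<otimes> w \<in> M} = Q"
  proof (rule only[OF a(3)])
    show "J \<subseteq> {w \<in> carrier R. a \<otimes> w \<in> M}"
      using IM(3) ideal.I_l_closed[OF IM(1)] a(1) ideal.Icarr[OF J] by auto
    show "{w \<in> carrier R. a \<otimes> w \<in> M} \<subseteq> Q"
    proof
      fix w assume w: "w \<in> {w \<in> carrier R. a \<otimes> w \<in> M}"
      then have "w \<otimes> a \<in> M" using m_comm a(1) by auto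
      then show "w \<in> Q" using saturatedD[OF IM(2) _ a(1), of w] a(2) w by blast
    qed
  qed
  then have Qa: "q \<otimes> a \<in> M" if "q \<in> Q" for q using that m_comm[of q a] a(1) by auto
  have Mc: "insert a M \<subseteq> carrier R" using a(1) ideal.Icarr[OF IM(1)] by blast
  have Dac: "insert a (D n) \<subseteq> carrier R" for n using a(1) Dc by blast
  \<comment> \<open>Adjoining \<open>a\<close> to all ideals gives a sequence above the larger ideal \<open>M'\<close>, hence a stationary one.\<close>
  define E where "E n = saturation R Q (Idl (insert a (D n)))" for n
  define M' where "M' = saturation R Q (Idl (insert a M))"
  have IE: "ideal (E n) R" for n unfolding E_def using saturation_ideal[OF Q] genideal_ideal[OF Dac] by blast
  have IM': "ideal M' R" unfolding M'_def using saturation_ideal[OF Q] genideal_ideal[OF Mc] by blast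
  have ME: "M' \<subseteq> E n" for n unfolding E_def M'_def
    using D(3) Dac by (intro saturation_mono subset_Idl_subset) blast+
  have anti: "E j \<subseteq> E i" if "i \<le> j" for i j unfolding E_def
    using D(4)[OF that] Dac by (intro saturation_mono subset_Idl_subset) blast+
  have "insert a M \<subseteq> Idl (insert a M)" using genideal_self[OF Mc] .
  also have "\<dots> \<subseteq> M'" unfolding M'_def
    using ideal.Icarr[OF genideal_ideal[OF Mc]] by (intro saturation_increasing[OF Q]) blast
  finally have aM': "insert a M \<subseteq> M'" .
  then have "M' \<notin> F" using Mmax[of M'] a(2) by blast
  then have "\<not> bad M' E"
    unfolding F_def using IM' saturation_idem[OF Q] aM' IM(3) unfolding M'_def by blast
  moreover have "saturation R Q (E n) \<subseteq> E n" for n unfolding E_def by (rule saturation_idem[OF Q])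
  ultimately obtain n where n: "\<forall>k\<ge>n. E k = E n"
    unfolding bad_def using IE ME anti by auto
  have stable: "saturation R Q (Idl (insert a (D k))) = saturation R Q (Idl (insert a (D n)))"
    if "k \<ge> n" for k using n that unfolding E_def by blast
  have "\<exists>n. \<forall>k\<ge>n. D k = D n"
    by (rule saturated_dcc_step[where C = D and n = n, OF Q IM(1,2) a(1,2) Qa D stable])
  then show False using nstab by blast
qed

end

section \<open>Krull's principal ideal theorem\<close>

context noetherian_cring
begin

text \<open>Krull's principal ideal theorem, in the form needed to move a chain of primes through \<open>x\<close>. If
  there were no such prime, \<open>Q\<close> would be minimal over \<open>P0 + Rx\<close>, so that the descending chain of the
  ideals \<open>S n + Rx\<close>, where \<open>S n\<close> are the symbolic powers of \<open>P1\<close> modulo \<open>P0\<close>, becomes stationary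
  locally at \<open>Q\<close>. Then, locally at \<open>Q\<close>, \<open>S n\<close> lies in \<open>S (n + 1) + x (S n)\<close>, because \<open>x\<close> is outside
  \<open>P1\<close>. Nakayama's lemma at \<open>Q\<close> gives \<open>S n = S (n + 1)\<close>, and Nakayama's lemma at \<open>P1\<close> then
  puts a power of \<open>P1\<close> into \<open>P0\<close>.\<close>

lemma exists_prime_between:
  assumes P0: "primeideal P0 R" and P1: "primeideal P1 R" and Q: "primeideal Q R"
    and sub: "P0 \<subset> P1" "P1 \<subset> Q" and x: "x \<in> Q"
  shows "\<exists>P. primeideal P R \<and> P0 \<subset> P \<and> P \<subset> Q \<and> x \<in> P"
proof (rule ccontr)
  assume no: "\<not> ?thesis"
  have I: "ideal P0 R" "ideal P1 R" "ideal Q R"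
    using P0 P1 Q by (auto intro: primeideal.axioms)
  have c0: "P0 \<subseteq> carrier R" and c1: "P1 \<subseteq> carrier R" using ideal.Icarr[OF I(1)] ideal.Icarr[OF I(2)] by auto
  have xc: "x \<in> carrier R" using ideal.Icarr[OF I(3) x] .
  have no': "P0 \<subset> P \<Longrightarrow> P \<subset> Q \<Longrightarrow> x \<notin> P" if "primeideal P R" for P using no that by auto
  have x1: "x \<in> carrier R - P1" using no'[OF P1 sub] xc by simp
  have Jc: "insert x P0 \<subseteq> carrier R" using xc c0 by blast
  have J: "ideal (Idl (insert x P0)) R" using Jc by (rule genideal_ideal)
  have only: "P = Q" if P: "primeideal P R" "Idl (insert x P0) \<subseteq> P" "P \<subseteq> Q" for P
  proof -
    have "x \<in> P" "P0 \<subseteq> P" using P(2) genideal_self[OF Jc] by auto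
    moreover from this have "P0 \<subset> P" using x1 sub(1) by blast
    ultimately show ?thesis using no'[OF P(1)] P(3) by auto
  qed
  define U where "U n = P0 <+>\<^bsub>R\<^esub> (P1 [^]\<^bsub>ideals_set R\<^esub> n)" for n :: nat
  \<comment> \<open>the \<open>n\<close>-th symbolic power of \<open>P1\<close> modulo \<open>P0\<close>\<close>
  define S where "S n = saturation R P1 (U n)" for n
  define C where "C n = saturation R Q (Idl (insert x (S n)))" for n
  have IP: "ideal (P1 [^]\<^bsub>ideals_set R\<^esub> n) R" for n :: nat by (rule ideal_pow[OF I(2)])
  have IU: "ideal (U n) R" for n unfolding U_def by (rule add_ideals[OF I(1) IP])
  have IS: "ideal (S n) R" for n unfolding S_def by (rule saturation_ideal[OF P1 IU])
  have Sc: "S n \<subseteq> carrier R" for n using ideal.Icarr[OF IS] by (rule subsetI)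
  have xSc: "insert x (S n) \<subseteq> carrier R" for n using Sc xc by simp
  have IC: "ideal (C n) R" for n unfolding C_def
    by (rule saturation_ideal[OF Q genideal_ideal[OF xSc]])
  have SatC: "saturation R Q (C n) \<subseteq> C n" for n unfolding C_def by (rule saturation_idem[OF Q])
  have SatS: "saturation R P1 (S n) \<subseteq> S n" for n unfolding S_def by (rule saturation_idem[OF P1])
  have US: "U n \<subseteq> S n" for n unfolding S_def
    by (rule saturation_increasing[OF P1 subsetI]) (rule ideal.Icarr[OF IU])
  have IdC: "Idl (insert x (S n)) \<subseteq> C n" for n unfolding C_def
    by (rule saturation_increasing[OF Q subsetI]) (rule ideal.Icarr[OF genideal_ideal[OF xSc]])
  have PU: "P0 \<subseteq> U n" "P1 [^]\<^bsub>ideals_set R\<^esub> n \<subseteq> U n" for n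
  proof -
    have "P0 \<union> P1 [^]\<^bsub>ideals_set R\<^esub> n \<subseteq> carrier R" using c0 ideal.Icarr[OF IP] by blast
    from genideal_self[OF this] have "P0 \<union> P1 [^]\<^bsub>ideals_set R\<^esub> n \<subseteq> U n"
      unfolding U_def union_genideal[OF I(1) IP, symmetric] .
    then show "P0 \<subseteq> U n" "P1 [^]\<^bsub>ideals_set R\<^esub> n \<subseteq> U n" by auto
  qed
  have "insert x P0 \<subseteq> insert x (S n)" for n using PU US by blast
  then have JC: "Idl (insert x P0) \<subseteq> C n" for n
    using subset_Idl_subset[OF xSc] IdC by (meson order_trans)
  have "U (Suc n) \<subseteq> U n" for n
    unfolding U_def ideal_prod_Suc_pow set_add_def' using ideal_prod_inter[OF IP I(2)] by fast
  then have SS: "S (Suc n) \<subseteq> S n" for n unfolding S_def by (rule saturation_mono)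
  have "C (Suc n) \<subseteq> C n" for n
    unfolding C_def using SS xSc by (intro saturation_mono subset_Idl_subset) blast+
  then have anti: "C j \<subseteq> C i" if "i \<le> j" for i j using that by (rule lift_Suc_antimono_le)
  have "\<exists>n. \<forall>k\<ge>n. C k = C n"
    by (rule saturated_dcc[OF Q J only IC SatC JC anti])
  then obtain n where n: "C (Suc n) = C n" by (metis le_Suc_eq order_refl)
  have step: "\<exists>s\<in>carrier R - Q. \<exists>l\<in>S (Suc n). \<exists>v\<in>S n \<cdot> Q. s \<otimes> a = l \<oplus> v" if a: "a \<in> S n" for a
  proof -
    have ac: "a \<in> carrier R" using a Sc by blast
    have "a \<in> C n" using a genideal_self[OF xSc] IdC by blast
    then have "a \<in> C (Suc n)" using n by simp
    then obtain s where s: "s \<in> carrier R - Q" "s \<otimes> a \<in> Idl (insert x (S (Suc n)))"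
      unfolding C_def saturation_def by blast
    obtain c b where cb: "c \<in> carrier R" "b \<in> Idl (S (Suc n))" "s \<otimes> a = c \<otimes> x \<oplus> b"
      by (rule Idl_insertE[OF s(2) xc Sc])
    have b: "b \<in> S (Suc n)" using cb(2) Idl_ideal[OF IS] by simp
    then have bc: "b \<in> carrier R" and bn: "b \<in> S n" using Sc SS by blast+
    have "x \<otimes> c = s \<otimes> a \<ominus> b" unfolding cb(3) using cb(1) xc bc by algebra
    also have "\<dots> \<in> S n" using ideal_minus[OF IS] ideal.I_l_closed[OF IS a] s(1) bn by simp
    finally have "c \<in> S n" using saturatedD[OF SatS x1 cb(1)] by simp
    then have "c \<otimes> x \<in> S n \<cdot> Q" using x by (rule ideal_prod.prod)
    moreover have "s \<otimes> a = b \<oplus> c \<otimes> x" unfolding cb(3) using cb(1) xc bc by (simp add: a_comm)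
    ultimately show ?thesis using s(1) b by blast
  qed
  obtain t where t: "t \<in> carrier R - Q" "\<And>a. a \<in> S n \<Longrightarrow> t \<otimes> a \<in> S (Suc n)"
    using nakayama_at_prime[OF Q IS IS step] by metis
  have t1: "t \<in> carrier R - P1" using t(1) sub(2) by blast
  have Sn: "a \<in> S (Suc n)" if "a \<in> S n" for a
    by (rule saturatedD[OF SatS t1 _ t(2)[OF that]]) (use that Sc in blast)
  have step': "\<exists>s\<in>carrier R - P1. \<exists>l\<in>P0. \<exists>v\<in>(P1 [^]\<^bsub>ideals_set R\<^esub> n) \<cdot> P1. s \<otimes> a = l \<oplus> v"
    if a: "a \<in> P1 [^]\<^bsub>ideals_set R\<^esub> n" for a
  proof -
    have "a \<in> S (Suc n)" using a PU(2) US Sn by blast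
    then show ?thesis unfolding S_def saturation_def U_def set_add_def' ideal_prod_Suc_pow by blast
  qed
  obtain u where u: "u \<in> carrier R - P1" "\<And>a. a \<in> P1 [^]\<^bsub>ideals_set R\<^esub> n \<Longrightarrow> u \<otimes> a \<in> P0"
    using nakayama_at_prime[OF P1 I(1) IP step'] by metis
  obtain p where p: "p \<in> P1" "p \<notin> P0" using sub(1) by blast
  have pc: "p \<in> carrier R" using p(1) c1 by blast
  have "u \<otimes> p [^] n \<in> P0" using u(2) pow_mem_ideal_pow[OF p(1) c1] by blast
  then show False
    using prime_mult_notin[OF P0 _ prime_pow_notin[OF P0], of u p n] u(1) sub(1) p pc by blast
qed

end

section \<open>Regular systems of parameters\<close>

definition prime_chain :: "('a, 'm) ring_scheme \<Rightarrow> (nat \<Rightarrow> 'a set) \<Rightarrow> nat \<Rightarrow> bool" where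
  "prime_chain R P n \<longleftrightarrow> (\<forall>i\<le>n. primeideal (P i) R) \<and> (\<forall>i<n. P i \<subset> P (Suc i))"

text \<open>Only the lowest step of the chain is lost when all its members are made to contain \<open>x\<close>: starting
  at the top, each intermediate prime is exchanged for one that contains \<open>x\<close>.\<close>

lemma (in noetherian_cring) prime_chain_through:
  assumes "prime_chain R P (Suc n)" "x \<in> P (Suc n)"
  shows "\<exists>P'. prime_chain R P' n \<and> P 0 \<subset> P' 0 \<and> x \<in> P' 0 \<and> P' n = P (Suc n)"
  using assms
proof (induction n arbitrary: P)
  case 0
  then show ?case by (intro exI[of _ "\<lambda>_. P 1"]) (auto simp: prime_chain_def)
next
  case (Suc n)
  have pr: "primeideal (P i) R" if "i \<le> Suc (Suc n)" for i
    using Suc.prems(1) that unfolding prime_chain_def by blast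
  have st: "P i \<subset> P (Suc i)" if "i < Suc (Suc n)" for i
    using Suc.prems(1) that unfolding prime_chain_def by blast
  have "\<exists>Q. primeideal Q R \<and> P n \<subset> Q \<and> Q \<subset> P (Suc (Suc n)) \<and> x \<in> Q"
    by (rule exists_prime_between[of _ "P (Suc n)"]) (simp_all add: pr st Suc.prems(2))
  then obtain Q where Q: "primeideal Q R" "P n \<subset> Q" "Q \<subset> P (Suc (Suc n))" "x \<in> Q" by blast
  have "prime_chain R (P(Suc n := Q)) (Suc n)"
    unfolding prime_chain_def using pr st Q by (auto simp: less_Suc_eq)
  from Suc.IH[OF this] Q(4) obtain P' where P': "prime_chain R P' n" "P 0 \<subset> P' 0" "x \<in> P' 0" "P' n = Q"
    by auto
  have "prime_chain R (P'(Suc n := P (Suc (Suc n)))) (Suc n)"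
    using P'(1,4) Q(3) pr[of "Suc (Suc n)"] unfolding prime_chain_def by (auto simp: less_Suc_eq le_Suc_eq)
  then show ?case
    by (rule_tac exI[of _ "P'(Suc n := P (Suc (Suc n)))"], intro conjI) (simp_all add: P'(2,3) fun_upd_def)
qed

locale noetherian_local_ring = local_ring R \<mm> + noetherian_ring R for R (structure) and \<mm>

sublocale noetherian_local_ring \<subseteq> noetherian_cring ..

sublocale regular_local_ring \<subseteq> noetherian_local_ring ..

context noetherian_local_ring
begin

lemma maximal: "maximalideal \<mm> R"
  using maximalideal_iff by simp

lemma prime_m: "primeideal \<mm> R"
  using maximalideal_prime[OF maximal] .

lemma ideal_m: "ideal \<mm> R"
  using primeideal.axioms(1)[OF prime_m] .

lemma proper_ideal_subset_m:
  assumes J: "ideal J R" "J \<noteq> carrier R"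
  shows "J \<subseteq> \<mm>"
proof -
  define F where "F = {B. ideal B R \<and> J \<subseteq> B \<and> B \<noteq> carrier R}"
  have "F \<noteq> {}" using J unfolding F_def by auto
  moreover have "ideal B R" if "B \<in> F" for B using that unfolding F_def by simp
  ultimately have "\<exists>M\<in>F. \<forall>B\<in>F. M \<subseteq> B \<longrightarrow> B = M" by (rule exists_maximal_ideal_in)
  then obtain M where M: "M \<in> F" "\<And>B. B \<in> F \<Longrightarrow> M \<subseteq> B \<Longrightarrow> B = M" by blast
  have "maximalideal M R"
  proof (rule maximalidealI)
    show "ideal M R" "carrier R \<noteq> M" using M(1) unfolding F_def by auto
    fix B assume B: "ideal B R" "M \<subseteq> B" "B \<subseteq> carrier R"
    have "J \<subseteq> B" using M(1) B(2) unfolding F_def by auto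
    then show "B = M \<or> B = carrier R" using M(2)[of B] B unfolding F_def by auto
  qed
  then have "M = \<mm>" using maximalideal_iff by simp
  then show ?thesis using M(1) unfolding F_def by auto
qed

lemma inverse_outside_m:
  assumes "u \<in> carrier R" "u \<notin> \<mm>"
  obtains v where "v \<in> carrier R" "v \<otimes> u = \<one>"
proof -
  have "PIdl u = carrier R"
    using proper_ideal_subset_m[OF cgenideal_ideal[OF assms(1)]] cgenideal_self[OF assms(1)] assms(2)
    by auto
  then have "\<one> \<in> PIdl u" by simp
  then obtain v where "v \<in> carrier R" "\<one> = v \<otimes> u" unfolding cgenideal_def by auto
  then show thesis using that by simp
qed

lemma mem_of_unit_mult:
  assumes J: "ideal J R" and u: "u \<in> carrier R - \<mm>" and w: "w \<in> carrier R" "u \<otimes> w \<in> J"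
  shows "w \<in> J"
proof -
  obtain v where v: "v \<in> carrier R" "v \<otimes> u = \<one>" using inverse_outside_m[of u] u by blast
  have "w = v \<otimes> (u \<otimes> w)" using v u w(1) by (simp add: m_assoc[symmetric])
  then show ?thesis using ideal.I_l_closed[OF J w(2) v(1)] by simp
qed

text \<open>Each generator cuts the length of a chain by one only, by the principal ideal theorem;
  if there are as many generators as steps, no step may be lost, and so the chain has to start at
  the smallest possible ideal.\<close>

lemma chain_start_unique:
  assumes "finite U" "S \<subseteq> carrier R" "z ` U \<subseteq> carrier R" "\<mm> = Idl (S \<union> z ` U)"
    and "prime_chain R P (card U)" "S \<subseteq> P 0" "P (card U) = \<mm>"
  shows "P 0 = Idl S"
  using assms
proof (induction U arbitrary: S P rule: finite_induct)
  case empty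
  then show ?case by simp
next
  case (insert u U)
  have zu: "z u \<in> carrier R" and zU: "z ` U \<subseteq> carrier R" using insert.prems by auto
  have c: "card (insert u U) = Suc (card U)" using insert.hyps by simp
  have "S \<union> z ` insert u U \<subseteq> carrier R" using insert.prems by blast
  from genideal_self[OF this] have "z u \<in> \<mm>" using insert.prems(3) by auto
  then obtain P' where P': "prime_chain R P' (card U)" "P 0 \<subset> P' 0" "z u \<in> P' 0" "P' (card U) = \<mm>"
    using prime_chain_through[of P "card U" "z u"] insert.prems(4,6) unfolding c by auto
  have zS: "insert (z u) S \<subseteq> carrier R" using zu insert.prems(1) by blast
  have start: "P' 0 = Idl (insert (z u) S)"
  proof (rule insert.IH[OF zS zU _ P'(1) _ P'(4)])
    show "\<mm> = Idl (insert (z u) S \<union> z ` U)" using insert.prems(3) by simp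
    show "insert (z u) S \<subseteq> P' 0" using P' insert.prems(5) by blast
  qed
  have pr: "primeideal (P 0) R" using insert.prems(4) unfolding prime_chain_def by blast
  have I: "ideal (P 0) R" using pr by (rule primeideal.axioms)
  have IS: "ideal (Idl S) R" using insert.prems(1) by (rule genideal_ideal)
  have SP: "Idl S \<subseteq> P 0" using I insert.prems(5) by (rule genideal_minimal)
  \<comment> \<open>As \<open>z u\<close> is outside the prime \<open>P 0\<close>, the ideal \<open>P 0\<close> lies in \<open>Idl S + (z u) (P 0)\<close>, and Nakayama's
    lemma applies.\<close>
  have zP: "z u \<notin> P 0"
  proof
    assume "z u \<in> P 0"
    then have "insert (z u) S \<subseteq> P 0" using insert.prems(5) by simp
    from genideal_minimal[OF I this] show False using start P'(2) by blast
  qed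
  have step: "\<exists>s\<in>carrier R - \<mm>. \<exists>l\<in>Idl S. \<exists>v\<in>P 0 \<cdot> \<mm>. s \<otimes> p = l \<oplus> v" if p: "p \<in> P 0" for p
  proof -
    have pc: "p \<in> carrier R" using ideal.Icarr[OF I p] .
    have "p \<in> Idl (insert (z u) S)" using p P'(2) start by blast
    then obtain q v where qv: "q \<in> carrier R" "v \<in> Idl S" "p = q \<otimes> z u \<oplus> v"
      using Idl_insertE zu insert.prems(1) by blast
    have vc: "v \<in> carrier R" using ideal.Icarr[OF IS qv(2)] .
    have "q \<otimes> z u = p \<ominus> v" unfolding qv(3) using qv(1) vc zu by algebra
    also have "\<dots> \<in> P 0" using ideal_minus[OF I p] SP qv(2) by blast
    finally have "q \<in> P 0" using primeideal.I_prime[OF pr qv(1) zu] zP by blast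
    then have "q \<otimes> z u \<in> P 0 \<cdot> \<mm>" using \<open>z u \<in> \<mm>\<close> by (rule ideal_prod.prod)
    moreover have "\<one> \<otimes> p = v \<oplus> q \<otimes> z u" using pc unfolding qv(3) using qv(1) vc zu by algebra
    ultimately show ?thesis using prime_one[OF prime_m] qv(2) by blast
  qed
  obtain t where t: "t \<in> carrier R - \<mm>" "\<And>a. a \<in> P 0 \<Longrightarrow> t \<otimes> a \<in> Idl S"
    using nakayama_at_prime[OF prime_m IS I step] by metis
  have "P 0 \<subseteq> Idl S"
    using mem_of_unit_mult[OF IS t(1) _ t(2)] ideal.Icarr[OF I] by blast
  then show ?case using SP by blast
qed

end

text \<open>The chain says that the dimension is at least the number of generators of the maximal ideal.\<close>

locale regular_parameters = noetherian_local_ring R \<mm> for R (structure) and \<mm> +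
  fixes z :: "'i \<Rightarrow> 'a" and D :: "'i set"
  assumes fin: "finite D" and zc: "i \<in> D \<Longrightarrow> z i \<in> carrier R"
    and gen: "\<mm> = Idl (z ` D)"
    and dim: "\<exists>P. prime_chain R P (card D) \<and> P (card D) = \<mm>"
begin

lemma zTc: "T \<subseteq> D \<Longrightarrow> z ` T \<subseteq> carrier R"
  using zc by blast

lemma z_mem_m: "i \<in> D \<Longrightarrow> z i \<in> \<mm>"
  using genideal_self[OF zTc[OF order_refl]] gen by blast

lemma prime_chain_above:
  assumes "T \<subseteq> D"
  shows "\<exists>P. prime_chain R P (card (D - T)) \<and> z ` T \<subseteq> P 0 \<and> P (card (D - T)) = \<mm>"
proof -
  have "finite T" using assms fin finite_subset by blast
  then show ?thesis using assms
  proof (induction T rule: finite_induct)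
    case empty
    then show ?case using dim by simp
  next
    case (insert i T)
    then obtain P where P: "prime_chain R P (card (D - T))" "z ` T \<subseteq> P 0" "P (card (D - T)) = \<mm>" by auto
    have "D - T = insert i (D - insert i T)" using insert by auto
    then have c: "card (D - T) = Suc (card (D - insert i T))"
      using fin by (metis card_insert_disjoint finite_Diff Diff_iff insertI1)
    obtain P' where "prime_chain R P' (card (D - insert i T))" "P 0 \<subset> P' 0" "z i \<in> P' 0"
      "P' (card (D - insert i T)) = \<mm>"
      using prime_chain_through[of P "card (D - insert i T)" "z i"] P z_mem_m[of i] insert.prems
      unfolding c by auto
    then show ?case using P(2) by (intro exI[of _ P']) auto
  qed
qed

lemma prime_chain_above_start:
  assumes "T \<subseteq> D" "prime_chain R P (card (D - T))" "z ` T \<subseteq> P 0" "P (card (D - T)) = \<mm>"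
  shows "P 0 = Idl (z ` T)"
proof (rule chain_start_unique[OF _ zTc[OF assms(1)] _ _ assms(2-4)])
  have "z ` T \<union> z ` (D - T) = z ` D" using assms(1) by blast
  then show "\<mm> = Idl (z ` T \<union> z ` (D - T))" using gen by simp
qed (use fin zc in auto)

text \<open>Regular local rings are domains, and so are their quotients by some of the parameters: by
  the two preceding lemmas the generated ideal is the first member of a chain of primes.\<close>

lemma prime_Idl_subset:
  assumes "T \<subseteq> D"
  shows "primeideal (Idl (z ` T)) R"
proof -
  obtain P where P: "prime_chain R P (card (D - T))" "z ` T \<subseteq> P 0" "P (card (D - T)) = \<mm>"
    using prime_chain_above[OF assms] by blast
  then show ?thesis using prime_chain_above_start[OF assms P] unfolding prime_chain_def by force
qed

lemma parameter_notin_Idl: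
  assumes T: "T \<subseteq> D" and j: "j \<in> D" "j \<notin> T"
  shows "z j \<notin> Idl (z ` T)"
proof
  assume zj: "z j \<in> Idl (z ` T)"
  obtain P where P: "prime_chain R P (card (D - T))" "z ` T \<subseteq> P 0" "P (card (D - T)) = \<mm>"
    using prime_chain_above[OF T] by blast
  have P0: "P 0 = Idl (z ` T)" by (rule prime_chain_above_start[OF T P])
  have "D - T = insert j (D - insert j T)" using j by auto
  then have c: "card (D - T) = Suc (card (D - insert j T))"
    using fin by (metis card_insert_disjoint finite_Diff Diff_iff insertI1)
  obtain P' where P': "prime_chain R P' (card (D - insert j T))" "P 0 \<subset> P' 0" "z j \<in> P' 0"
    "P' (card (D - insert j T)) = \<mm>"
    using prime_chain_through[of P "card (D - insert j T)" "z j"] P z_mem_m[OF j(1)] unfolding c by auto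
  have iT: "insert j T \<subseteq> D" using T j by blast
  have "z ` insert j T \<subseteq> P' 0" using P' P by auto
  then have "P' 0 = Idl (z ` insert j T)" using prime_chain_above_start[OF iT P'(1) _ P'(4)] by blast
  also have "\<dots> \<subseteq> Idl (z ` T)"
    using zj genideal_self[OF zTc[OF T]] by (intro genideal_minimal genideal_ideal zTc T) auto
  finally show False using P'(2) P0 by blast
qed

end

section \<open>Monomials in a regular system of parameters\<close>

context regular_parameters
begin

abbreviation power_ideal :: "('i \<Rightarrow> nat) \<Rightarrow> 'i set \<Rightarrow> 'a set" where
  "power_ideal c T \<equiv> Idl ((\<lambda>i. z i [^] c i) ` T)"

lemma power_gens_carrier: "T \<subseteq> D \<Longrightarrow> (\<lambda>i. z i [^] (c i::nat)) ` T \<subseteq> carrier R"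
  using zc by auto

lemma ideal_power_ideal: "T \<subseteq> D \<Longrightarrow> ideal (power_ideal c T) R"
  by (intro genideal_ideal power_gens_carrier)

lemma power_ideal_split:
  assumes "T \<subseteq> D" "k \<in> T"
  shows "power_ideal c T = {q \<otimes> z k [^] c k \<oplus> v | q v. q \<in> carrier R \<and> v \<in> power_ideal c (T - {k})}"
proof -
  have T: "T - {k} \<subseteq> D" and k: "k \<in> D" using assms by auto
  have "(\<lambda>i. z i [^] c i) ` T = insert (z k [^] c k) ((\<lambda>i. z i [^] c i) ` (T - {k}))"
    using assms(2) by auto
  then show ?thesis using Idl_insert[OF _ power_gens_carrier[OF T]] zc[OF k] by simp
qed

lemma power_ideal_cong: "(\<And>i. i \<in> T \<Longrightarrow> c i = c' i) \<Longrightarrow> power_ideal c T = power_ideal c' T"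
  by (metis (no_types, lifting) image_cong)

text \<open>The case in which all exponents are \<open>1\<close> is the primality of \<open>Idl (z ` T)\<close>. Larger exponents are
  reached by induction on their sum: with \<open>Z = (z k)\<^sup>m\<close> and \<open>c k = m + 1\<close>, one first writes \<open>f = gZ\<close>
  modulo the other powers, cancels \<open>Z\<close> from \<open>(z j) f = h Z (z k)\<close>, and finds that \<open>g\<close> is divisible by
  \<open>z k\<close> modulo the other powers.\<close>

lemma parameter_nonzerodivisor:
  assumes "T \<subseteq> D" "j \<in> D" "j \<notin> T" "\<And>i. i \<in> T \<Longrightarrow> c i \<ge> 1"
    and "f \<in> carrier R" "z j \<otimes> f \<in> power_ideal c T"
  shows "f \<in> power_ideal c T"
  using assms
proof (induction "\<Sum>i\<in>T. c i" arbitrary: T j c f rule: less_induct)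
  case less
  have finT: "finite T" using less.prems(1) fin finite_subset by blast
  have zj: "z j \<in> carrier R" using zc less.prems(2) .
  have f: "f \<in> carrier R" by (rule less.prems(5))
  show ?case
  proof (cases "\<forall>i\<in>T. c i = 1")
    case True
    then have "(\<lambda>i. z i [^] c i) ` T = z ` T" using zc less.prems(1) by (intro image_cong) (auto simp: subset_iff)
    then show ?thesis
      using primeideal.I_prime[OF prime_Idl_subset[OF less.prems(1)] zj f]
        parameter_notin_Idl[OF less.prems(1-3)] less.prems(6) by auto
  next
    case False
    then obtain k where k: "k \<in> T" "c k \<noteq> 1" by blast
    then obtain m where m: "c k = Suc m" "m \<ge> 1" using less.prems(4)[of k] by (cases "c k") auto
    have zk: "z k \<in> carrier R" using zc k(1) less.prems(1) by blast
    define Z where "Z = z k [^] m"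
    have Z: "Z \<in> carrier R" unfolding Z_def using zk by simp
    have Zk: "z k [^] c k = Z \<otimes> z k" unfolding m(1) Z_def by simp
    define L where "L = power_ideal c (T - {k})"
    have Tk: "T - {k} \<subseteq> D" using less.prems(1) by blast
    have L: "ideal L R" unfolding L_def by (rule ideal_power_ideal[OF Tk])
    have Lc: "l \<in> carrier R" if "l \<in> L" for l using ideal.Icarr[OF L that] .
    have K: "power_ideal (c(k := n)) T = {q \<otimes> z k [^] n \<oplus> v | q v. q \<in> carrier R \<and> v \<in> L}" for n
    proof -
      have "power_ideal (c(k := n)) (T - {k}) = L" unfolding L_def by (rule power_ideal_cong) simp
      then show ?thesis using power_ideal_split[OF less.prems(1) k(1), of "c(k := n)"] by simp
    qed
    have cK: "c(k := c k) = c" by simp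
    have smaller: "(\<Sum>i\<in>T. (c(k := n)) i) < (\<Sum>i\<in>T. c i)" if "n < c k" for n
      using finT k(1) that by (intro sum_strict_mono_ex1) auto
    have cancel: "w \<in> L" if "w \<in> carrier R" "z k [^] n \<otimes> w \<in> L" for w and n :: nat
      using that
    proof (induction n arbitrary: w)
      case 0
      then show ?case by simp
    next
      case (Suc n)
      have "z k \<otimes> (z k [^] n \<otimes> w) \<in> L"
        using Suc.prems zk by (simp add: m_ac)
      then have zw: "z k \<otimes> (z k [^] n \<otimes> w) \<in> power_ideal c (T - {k})" unfolding L_def .
      have lt: "(\<Sum>i\<in>T - {k}. c i) < (\<Sum>i\<in>T. c i)"
        using finT k(1) m(1) by (simp add: sum.remove)
      have "z k [^] n \<otimes> w \<in> L"
        unfolding L_def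
        by (rule less.hyps[OF lt Tk _ _ _ _ zw]) (use less.prems(1,4) k(1) zk Suc.prems(1) in auto)
      then show ?case by (rule Suc.IH[OF Suc.prems(1)])
    qed
    obtain h l' where h: "h \<in> carrier R" "l' \<in> L" "z j \<otimes> f = h \<otimes> (Z \<otimes> z k) \<oplus> l'"
      using less.prems(6) K[of "c k"] unfolding cK Zk by blast
    have "z j \<otimes> f = (h \<otimes> z k) \<otimes> Z \<oplus> l'"
      unfolding h(3) using h(1) Z zk Lc[OF h(2)] by (simp add: m_ac)
    then have zf: "z j \<otimes> f \<in> power_ideal (c(k := m)) T"
      unfolding K Z_def[symmetric] using h zk by blast
    have "f \<in> power_ideal (c(k := m)) T"
      by (rule less.hyps[OF smaller less.prems(1-3) _ f zf]) (use less.prems(4) m in auto)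
    then obtain g l where g: "g \<in> carrier R" "l \<in> L" "f = g \<otimes> Z \<oplus> l"
      unfolding K Z_def[symmetric] by blast
    \<comment> \<open>comparing the two expressions of \<open>z j \<otimes> f\<close>\<close>
    have "Z \<otimes> (z j \<otimes> g \<ominus> z k \<otimes> h) = (z j \<otimes> f \<ominus> z j \<otimes> l) \<ominus> h \<otimes> (Z \<otimes> z k)"
      unfolding g(3) using Z zj zk g(1) h(1) Lc[OF g(2)] by algebra
    also have "\<dots> = l' \<ominus> z j \<otimes> l"
      unfolding h(3) using Z zj zk g(1) h(1) Lc[OF g(2)] Lc[OF h(2)] by algebra
    also have "\<dots> \<in> L" using ideal_minus[OF L h(2)] ideal.I_l_closed[OF L g(2) zj] .
    finally have "z k [^] m \<otimes> (z j \<otimes> g \<ominus> z k \<otimes> h) \<in> L" unfolding Z_def .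
    then have w: "z j \<otimes> g \<ominus> z k \<otimes> h \<in> L"
      using cancel[of "z j \<otimes> g \<ominus> z k \<otimes> h" m] zj zk g(1) h(1) by simp
    have "z j \<otimes> g = h \<otimes> z k [^] (1::nat) \<oplus> (z j \<otimes> g \<ominus> z k \<otimes> h)"
      using zj zk g(1) h(1) by (simp, algebra)
    then have zg: "z j \<otimes> g \<in> power_ideal (c(k := 1)) T" unfolding K using h(1) w by blast
    have "g \<in> power_ideal (c(k := 1)) T"
      by (rule less.hyps[OF smaller less.prems(1-3) _ g(1) zg]) (use less.prems(4) m in auto)
    then obtain e l2 where e: "e \<in> carrier R" "l2 \<in> L" "g = e \<otimes> z k \<oplus> l2"
      unfolding K using zk by auto
    have "f = e \<otimes> (Z \<otimes> z k) \<oplus> (Z \<otimes> l2 \<oplus> l)"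
      unfolding g(3) e(3) using e(1) Z zk Lc[OF e(2)] Lc[OF g(2)] by algebra
    moreover have "Z \<otimes> l2 \<oplus> l \<in> L"
      using ideal_add[OF L ideal.I_l_closed[OF L e(2) Z] g(2)] .
    ultimately show ?thesis using K[of "c k"] e(1) unfolding cK Zk by blast
  qed
qed

lemma parameter_power_nonzerodivisor:
  assumes "T \<subseteq> D" "j \<in> D" "j \<notin> T" "\<And>i. i \<in> T \<Longrightarrow> c i \<ge> 1"
    and "f \<in> carrier R" "z j [^] (n::nat) \<otimes> f \<in> power_ideal c T"
  shows "f \<in> power_ideal c T"
  using assms(5,6)
proof (induction n arbitrary: f)
  case (Suc n)
  have zj: "z j \<in> carrier R" using zc assms(2) .
  have "z j \<otimes> (z j [^] n \<otimes> f) \<in> power_ideal c T" using Suc.prems zj by (simp add: m_ac)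
  then have "z j [^] n \<otimes> f \<in> power_ideal c T"
    by (rule parameter_nonzerodivisor[OF assms(1-4), rotated 2]) (use Suc.prems(1) zj in auto)
  then show ?case by (rule Suc.IH[OF Suc.prems(1)])
qed simp

definition monomial :: "('i \<Rightarrow> nat) \<Rightarrow> 'a" where
  "monomial a = (\<Otimes>i\<in>D. z i [^] a i)"

lemma monomial_closed: "monomial a \<in> carrier R"
  unfolding monomial_def using zc by (intro finprod_closed) auto

text \<open>The factors \<open>(z k)\<^sup>(a k)\<close> are cancelled one at a time, which lowers the corresponding exponent on
  the right to \<open>1\<close>; in the end \<open>1\<close> would lie in the maximal ideal.\<close>

lemma partial_monomial_notin:
  assumes "U \<subseteq> D"
  shows "(\<Otimes>i\<in>U. z i [^] a i) \<notin> power_ideal (\<lambda>i. if i \<in> U then Suc (a i) else 1) D"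
proof -
  have "finite U" using assms fin finite_subset by blast
  then show ?thesis using assms
  proof (induction U rule: finite_induct)
    case empty
    have "(\<lambda>i. z i [^] (1::nat)) ` D = z ` D" using zc by (intro image_cong) auto
    then show ?case using gen prime_one[OF prime_m] by simp
  next
    case (insert k U)
    let ?c = "\<lambda>i. if i \<in> insert k U then Suc (a i) else 1"
    let ?c' = "\<lambda>i. if i \<in> U then Suc (a i) else 1"
    have k: "k \<in> D" and U: "U \<subseteq> D" using insert.prems by auto
    have zk: "z k \<in> carrier R" using zc k .
    have Dk: "D - {k} \<subseteq> D" by blast
    define w where "w = (\<Otimes>i\<in>U. z i [^] a i)"
    have w: "w \<in> carrier R" unfolding w_def using zc U by (intro finprod_closed) auto
    have prod: "(\<Otimes>i\<in>insert k U. z i [^] a i) = z k [^] a k \<otimes> w"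
      unfolding w_def using insert.hyps zc U k by (intro finprod_insert) auto
    define L where "L = power_ideal ?c (D - {k})"
    have L: "ideal L R" unfolding L_def by (rule ideal_power_ideal[OF Dk])
    have L': "L = power_ideal ?c' (D - {k})" unfolding L_def by (rule power_ideal_cong) simp
    show ?case
    proof
      assume "(\<Otimes>i\<in>insert k U. z i [^] a i) \<in> power_ideal ?c D"
      then obtain h l where h: "h \<in> carrier R" "l \<in> L" "z k [^] a k \<otimes> w = h \<otimes> z k [^] Suc (a k) \<oplus> l"
        unfolding prod power_ideal_split[OF order_refl k] L_def by auto
      have lc: "l \<in> carrier R" using ideal.Icarr[OF L h(2)] .
      define Z where "Z = z k [^] a k"
      have Z: "Z \<in> carrier R" unfolding Z_def using zk by simp
      have eq: "Z \<otimes> w = h \<otimes> (Z \<otimes> z k) \<oplus> l" using h(3) unfolding Z_def by simp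
      have "Z \<otimes> (w \<ominus> h \<otimes> z k) = Z \<otimes> w \<ominus> h \<otimes> (Z \<otimes> z k)" using Z w h(1) zk by algebra
      also have "\<dots> = l" unfolding eq using Z h(1) zk lc by algebra
      finally have "Z \<otimes> (w \<ominus> h \<otimes> z k) \<in> L" using h(2) by simp
      then have "w \<ominus> h \<otimes> z k \<in> power_ideal ?c (D - {k})"
        unfolding L_def Z_def
        by (rule parameter_power_nonzerodivisor[OF Dk k, rotated 3]) (simp_all add: w h(1) zk)
      then have wh: "w \<ominus> h \<otimes> z k \<in> L" unfolding L_def .
      have "w = h \<otimes> z k [^] ?c' k \<oplus> (w \<ominus> h \<otimes> z k)"
        using w h(1) zk insert.hyps(2) by (simp, algebra)
      then have "w \<in> power_ideal ?c' D"
        unfolding power_ideal_split[OF order_refl k, of ?c'] using h(1) wh unfolding L' by blast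
      then show False using insert.IH[OF U] unfolding w_def by blast
    qed
  qed
qed

text \<open>This is the ideal generated by all monomials that do not divide \<open>z\<^sup>a\<close>: such a monomial has a
  larger exponent than \<open>a\<close> at some place. It certifies that \<open>z\<^sup>a\<close> is not generated by other
  monomials.\<close>

abbreviation nondivisor_ideal :: "('i \<Rightarrow> nat) \<Rightarrow> 'a set" where
  "nondivisor_ideal a \<equiv> power_ideal (\<lambda>i. Suc (a i)) D"

lemma monomial_notin_nondivisor_ideal: "monomial a \<notin> nondivisor_ideal a"
proof -
  have "nondivisor_ideal a = power_ideal (\<lambda>i. if i \<in> D then Suc (a i) else 1) D"
    by (rule power_ideal_cong) simp
  then show ?thesis using partial_monomial_notin[OF order_refl, of a] unfolding monomial_def by simp
qed

lemma monomial_split: "k \<in> D \<Longrightarrow> monomial a = z k [^] a k \<otimes> (\<Otimes>i\<in>D - {k}. z i [^] a i)"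
proof -
  assume k: "k \<in> D"
  have "monomial a = (\<Otimes>i\<in>insert k (D - {k}). z i [^] a i)"
    unfolding monomial_def using k by (simp add: insert_absorb)
  also have "\<dots> = z k [^] a k \<otimes> (\<Otimes>i\<in>D - {k}. z i [^] a i)"
    using fin zc k by (intro finprod_insert) auto
  finally show ?thesis .
qed

lemma monomial_in_nondivisor_ideal:
  assumes "k \<in> D" "a k < b k"
  shows "monomial b \<in> nondivisor_ideal a"
proof -
  have I: "ideal (nondivisor_ideal a) R" by (rule ideal_power_ideal) simp
  have zk: "z k \<in> carrier R" using zc assms(1) .
  have "z k [^] Suc (a k) \<in> nondivisor_ideal a"
    using genideal_self[OF power_gens_carrier[OF order_refl], of "\<lambda>i. Suc (a i)"] assms(1) by blast
  moreover define w where "w = (\<Otimes>i\<in>D - {k}. z i [^] b i)"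
  moreover have w: "w \<in> carrier R" unfolding w_def using zc by (intro finprod_closed) auto
  moreover have "b k = Suc (a k) + (b k - Suc (a k))" using assms(2) by simp
  then have "z k [^] b k = z k [^] Suc (a k) \<otimes> z k [^] (b k - Suc (a k))"
    using nat_pow_mult[OF zk, of "Suc (a k)" "b k - Suc (a k)"] by simp
  then have "monomial b = (z k [^] (b k - Suc (a k)) \<otimes> w) \<otimes> z k [^] Suc (a k)"
    using monomial_split[OF assms(1), of b] zk w unfolding w_def[symmetric] by (simp add: m_ac)
  ultimately show ?thesis using ideal.I_l_closed[OF I] zk by simp
qed

lemma monomial_mult: "monomial a \<otimes> monomial b = monomial (\<lambda>i. a i + b i)"
proof -
  have "monomial a \<otimes> monomial b = (\<Otimes>i\<in>D. z i [^] a i \<otimes> z i [^] b i)"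
    unfolding monomial_def using zc by (intro finprod_multf[symmetric]) auto
  also have "\<dots> = monomial (\<lambda>i. a i + b i)"
    unfolding monomial_def using zc by (intro finprod_cong) (auto simp: nat_pow_mult)
  finally show ?thesis .
qed

lemma monomial_cong: "(\<And>i. i \<in> D \<Longrightarrow> a i = b i) \<Longrightarrow> monomial a = monomial b"
  unfolding monomial_def using zc by (intro finprod_cong) auto

lemma monomial_dvd:
  assumes J: "ideal J R" and a: "monomial a \<in> J" and le: "\<And>i. i \<in> D \<Longrightarrow> a i \<le> b i"
  shows "monomial b \<in> J"
proof -
  have "monomial b = monomial (\<lambda>i. (b i - a i) + a i)"
    by (rule monomial_cong) (use le in simp)
  also have "\<dots> = monomial (\<lambda>i. b i - a i) \<otimes> monomial a" by (rule monomial_mult[symmetric])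
  finally show ?thesis using ideal.I_l_closed[OF J a monomial_closed] by simp
qed

lemma monomial_update:
  assumes "k \<in> D" shows "z k \<otimes> monomial a = monomial (a(k := Suc (a k)))"
proof -
  have zk: "z k \<in> carrier R" using zc assms .
  have "(\<Otimes>i\<in>D - {k}. z i [^] (a(k := Suc (a k))) i) = (\<Otimes>i\<in>D - {k}. z i [^] a i)"
    using zc by (intro finprod_cong) auto
  moreover have "(\<Otimes>i\<in>D - {k}. z i [^] a i) \<in> carrier R"
    using zc by (intro finprod_closed) auto
  ultimately show ?thesis
    using monomial_split[OF assms, of a] monomial_split[OF assms, of "a(k := Suc (a k))"] zk
    by (simp add: m_ac)
qed

end

section \<open>Minimal numbers of generators\<close>

context noetherian_local_ring
begin

text \<open>A Steinitz exchange. In the expression of \<open>u\<close> by generators, the part supported on \<open>B\<close> and all terms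
  with coefficient in the maximal ideal lie in \<open>W\<close>; as \<open>u\<close> does not, some \<open>c\<close> in \<open>C\<close> has a unit as
  coefficient and can be solved for.\<close>

lemma generator_exchange:
  assumes "finite C" "C \<subseteq> carrier R" "B \<subseteq> carrier R" "C \<inter> B = {}"
    and W: "ideal W R" "B \<subseteq> W" and "\<And>q c. q \<in> \<mm> \<Longrightarrow> c \<in> C \<Longrightarrow> q \<otimes> c \<in> W"
    and "u \<in> Idl (C \<union> B)" "u \<notin> W"
  shows "\<exists>c\<in>C. c \<in> Idl (insert u ((C - {c}) \<union> B))"
  using assms(1,2,4,7-9)
proof (induction C arbitrary: u rule: finite_induct)
  case empty
  then show ?case using genideal_minimal[OF W] by auto
next
  case (insert c C)
  have c: "c \<in> carrier R" and CB: "C \<union> B \<subseteq> carrier R" using insert.prems(1) assms(3) by auto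
  have "u \<in> Idl (insert c (C \<union> B))" using insert.prems(4) by simp
  then obtain q v where qv: "q \<in> carrier R" "v \<in> Idl (C \<union> B)" "u = q \<otimes> c \<oplus> v"
    using c CB by (rule Idl_insertE)
  have vc: "v \<in> carrier R" using ideal.Icarr[OF genideal_ideal[OF CB] qv(2)] .
  have uc: "u \<in> carrier R" unfolding qv(3) using qv(1) vc c by simp
  show ?case
  proof (cases "q \<in> \<mm>")
    case False
    have sub: "insert u (C \<union> B) \<subseteq> carrier R" using uc CB by simp
    have I: "ideal (Idl (insert u (C \<union> B))) R" using sub by (rule genideal_ideal)
    have "v \<in> Idl (insert u (C \<union> B))"
      using qv(2) subset_Idl_subset[OF sub, of "C \<union> B"] by blast
    moreover have "u \<in> Idl (insert u (C \<union> B))" using genideal_self[OF sub] by simp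
    moreover have "q \<otimes> c = u \<ominus> v" unfolding qv(3) using qv(1) vc c by algebra
    ultimately have "q \<otimes> c \<in> Idl (insert u (C \<union> B))" using ideal_minus[OF I] by simp
    then have "c \<in> Idl (insert u (C \<union> B))"
      using mem_of_unit_mult[OF I _ c] qv(1) False by simp
    moreover have "insert c C - {c} = C" using insert.hyps by simp
    ultimately show ?thesis by (intro bexI[of _ c]) simp_all
  next
    case True
    have "v \<notin> W"
      using insert.prems(3)[OF True, of c] insert.prems(5) ideal_add[OF W(1)] unfolding qv(3) by blast
    moreover have "C \<subseteq> carrier R" "C \<inter> B = {}" using insert.prems by auto
    moreover have "q \<otimes> c' \<in> W" if "q \<in> \<mm>" "c' \<in> C" for q c' using insert.prems(3) that by simp
    ultimately obtain c' where c': "c' \<in> C" "c' \<in> Idl (insert v ((C - {c'}) \<union> B))"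
      using insert.IH[of v] qv(2) by blast
    let ?G = "insert u ((insert c C - {c'}) \<union> B)"
    have sub: "?G \<subseteq> carrier R" using uc CB c by blast
    have I: "ideal (Idl ?G) R" using sub by (rule genideal_ideal)
    have G: "?G \<subseteq> Idl ?G" using sub by (rule genideal_self)
    have cG: "c \<in> Idl ?G" using G c'(1) insert.hyps by blast
    have "v = u \<ominus> q \<otimes> c" unfolding qv(3) using qv(1) vc c by algebra
    then have "v \<in> Idl ?G" using ideal_minus[OF I _ ideal.I_l_closed[OF I cG qv(1)], of u] G by simp
    moreover have "(C - {c'}) \<union> B \<subseteq> ?G" by blast
    ultimately have "insert v ((C - {c'}) \<union> B) \<subseteq> Idl ?G" using G by auto
    from genideal_minimal[OF I this] have "c' \<in> Idl ?G" using c'(2) by blast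
    then show ?thesis using c'(1) by (intro bexI[of _ c']) simp_all
  qed
qed

text \<open>The ideal \<open>W\<close> attached to \<open>u\<close> contains \<open>\<mm> (Idl A)\<close> and the other elements of \<open>A\<close>. It expresses,
  without forming the vector space \<open>Idl A / \<mm> (Idl A)\<close>, that the class of \<open>u\<close> is independent of the
  others. The bound follows by exchanging elements of \<open>B\<close> for elements of \<open>A\<close>.\<close>

lemma independent_card_le:
  assumes A: "finite A" "A \<subseteq> carrier R"
    and indep: "\<And>u. u \<in> A \<Longrightarrow> \<exists>W. ideal W R \<and> u \<notin> W \<and> A - {u} \<subseteq> W \<and> (\<forall>q\<in>\<mm>. q \<otimes> u \<in> W)"
    and "finite B" "B \<subseteq> carrier R" "Idl B = Idl A"
  shows "card A \<le> card B"
  using assms(4-6)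
proof (induction "card (A - B)" arbitrary: B rule: less_induct)
  case less
  show ?case
  proof (cases "A \<subseteq> B")
    case True
    then show ?thesis using less.prems(1) by (intro card_mono)
  next
    case False
    then obtain u where u: "u \<in> A" "u \<notin> B" by blast
    then obtain W where W: "ideal W R" "u \<notin> W" "A - {u} \<subseteq> W" "\<And>q. q \<in> \<mm> \<Longrightarrow> q \<otimes> u \<in> W"
      using indep by blast
    have mA: "q \<otimes> a \<in> W" if "q \<in> \<mm>" "a \<in> A" for q a
      using that W(3,4) ideal.I_l_closed[OF W(1)] ideal.Icarr[OF ideal_m] by (cases "a = u") auto
    have IB: "ideal (Idl B) R" using less.prems(2) by (rule genideal_ideal)
    have BB: "B \<subseteq> Idl B" using less.prems(2) by (rule genideal_self)
    have mB: "q \<otimes> b \<in> W" if q: "q \<in> \<mm>" and b: "b \<in> B - A" for q b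
    proof (rule mult_Idl_subset[OF W(1) _ A(2)])
      show "q \<in> carrier R" using ideal.Icarr[OF ideal_m q] .
      show "b \<in> Idl A" using b BB less.prems(3) by auto
    qed (rule mA[OF q])
    have uB: "u \<in> Idl B" using u(1) genideal_self[OF A(2)] less.prems(3) by auto
    have split: "(B - A) \<union> (B \<inter> A) = B" by blast
    have "\<exists>c\<in>B - A. c \<in> Idl (insert u ((B - A - {c}) \<union> (B \<inter> A)))"
    proof (rule generator_exchange[OF _ _ _ _ W(1) _ mB _ W(2)])
      show "finite (B - A)" using less.prems(1) by simp
      show "B - A \<subseteq> carrier R" "B \<inter> A \<subseteq> carrier R" "(B - A) \<inter> (B \<inter> A) = {}"
        using less.prems(2) by auto
      show "B \<inter> A \<subseteq> W" using W(3) u(2) by blast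
      show "u \<in> Idl ((B - A) \<union> (B \<inter> A))" unfolding split by (rule uB)
    qed
    then obtain c where c: "c \<in> B" "c \<notin> A" "c \<in> Idl (insert u ((B - A - {c}) \<union> (B \<inter> A)))" by blast
    have "(B - A - {c}) \<union> (B \<inter> A) = B - {c}" using c(2) by blast
    then have cB: "c \<in> Idl (insert u (B - {c}))" using c(3) by simp
    define B' where "B' = insert u (B - {c})"
    have B'c: "B' \<subseteq> carrier R" unfolding B'_def using u(1) A(2) less.prems(2) by blast
    have "B' \<subseteq> Idl B" unfolding B'_def using uB BB by blast
    from genideal_minimal[OF IB this] have "Idl B' \<subseteq> Idl B" .
    moreover have "B \<subseteq> Idl B'"
      using genideal_self[OF B'c] cB unfolding B'_def by auto
    from genideal_minimal[OF genideal_ideal[OF B'c] this] have "Idl B \<subseteq> Idl B'" .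
    ultimately have "Idl B' = Idl A" using less.prems(3) by simp
    moreover have "A - B' \<subset> A - B" using u c(2) unfolding B'_def by blast
    then have "card (A - B') < card (A - B)" using A(1) by (intro psubset_card_mono) auto
    moreover have "finite B'" unfolding B'_def using less.prems(1) by simp
    ultimately have "card A \<le> card B'" using less.hyps[of B'] B'c by blast
    also have "card B' = card B"
      unfolding B'_def using less.prems(1) u(2) c(1)
      by (metis DiffD1 card_Suc_Diff1 card_insert_disjoint finite_Diff)
    finally show ?thesis .
  qed
qed

lemma min_gens_eq_card:
  assumes "finite A" "A \<subseteq> carrier R"
    and "\<And>u. u \<in> A \<Longrightarrow> \<exists>W. ideal W R \<and> u \<notin> W \<and> A - {u} \<subseteq> W \<and> (\<forall>q\<in>\<mm>. q \<otimes> u \<in> W)"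
  shows "min_gens R (Idl A) = card A"
  unfolding min_gens_def
proof (rule Least_equality)
  show "\<exists>B\<subseteq>carrier R. finite B \<and> card B = card A \<and> Idl B = Idl A" using assms(1,2) by blast
  fix n assume "\<exists>B\<subseteq>carrier R. finite B \<and> card B = n \<and> Idl B = Idl A"
  then show "card A \<le> n" using independent_card_le[OF assms] by blast
qed

end

section \<open>Monomial ideals in a regular system of parameters\<close>

context regular_parameters
begin

lemma monomial_mem_Idl_monomials:
  assumes "monomial a \<in> Idl (monomial ` E)"
  shows "\<exists>e\<in>E. \<forall>i\<in>D. e i \<le> a i"
proof (rule ccontr)
  assume n: "\<not> ?thesis"
  have "monomial ` E \<subseteq> nondivisor_ideal a"
  proof (rule image_subsetI)
    fix e assume "e \<in> E"
    then obtain k where "k \<in> D" "a k < e k" using n by (auto simp: not_le)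
    then show "monomial e \<in> nondivisor_ideal a" by (rule monomial_in_nondivisor_ideal)
  qed
  from genideal_minimal[OF ideal_power_ideal[OF order_refl] this] show False
    using assms monomial_notin_nondivisor_ideal by blast
qed

text \<open>The witness of independence for \<open>z\<^sup>a\<close> is the ideal of all monomials that do not divide it: it contains
  the other generators as well as all \<open>(z k) z\<^sup>a\<close>.\<close>

lemma min_gens_monomials:
  assumes fE: "finite E" and anti: "\<And>a b. a \<in> E \<Longrightarrow> b \<in> E \<Longrightarrow> a \<noteq> b \<Longrightarrow> \<exists>k\<in>D. a k < b k"
  shows "min_gens R (Idl (monomial ` E)) = card E"
proof -
  have other: "monomial b \<in> nondivisor_ideal a" if "a \<in> E" "b \<in> E" "a \<noteq> b" for a b
    using anti[OF that] monomial_in_nondivisor_ideal by blast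
  have "inj_on monomial E"
  proof (rule inj_onI, rule ccontr)
    fix a b assume "a \<in> E" "b \<in> E" "monomial a = monomial b" "a \<noteq> b"
    then show False using other[of a b] monomial_notin_nondivisor_ideal[of a] by simp
  qed
  then have "card (monomial ` E) = card E" by (rule card_image)
  moreover have "min_gens R (Idl (monomial ` E)) = card (monomial ` E)"
  proof (rule min_gens_eq_card)
    fix u assume "u \<in> monomial ` E"
    then obtain a where a: "a \<in> E" "u = monomial a" by blast
    have I: "ideal (nondivisor_ideal a) R" by (rule ideal_power_ideal) simp
    have "q \<otimes> monomial a \<in> nondivisor_ideal a" if q: "q \<in> \<mm>" for q
    proof -
      have "monomial a \<otimes> q \<in> nondivisor_ideal a"
      proof (rule mult_Idl_subset[OF I monomial_closed zTc[OF order_refl]])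
        show "q \<in> Idl (z ` D)" using q gen by simp
        fix s assume "s \<in> z ` D"
        then obtain k where k: "k \<in> D" "s = z k" by blast
        have "monomial a \<otimes> z k = monomial (a(k := Suc (a k)))"
          using monomial_update[OF k(1)] m_comm[OF monomial_closed zc[OF k(1)]] by simp
        also have "\<dots> \<in> nondivisor_ideal a" by (rule monomial_in_nondivisor_ideal[OF k(1)]) simp
        finally show "monomial a \<otimes> s \<in> nondivisor_ideal a" using k(2) by simp
      qed
      then show ?thesis using m_comm[OF monomial_closed ideal.Icarr[OF ideal_m q]] by simp
    qed
    moreover have "monomial ` E - {u} \<subseteq> nondivisor_ideal a" using other a by blast
    ultimately show "\<exists>W. ideal W R \<and> u \<notin> W \<and> monomial ` E - {u} \<subseteq> W \<and> (\<forall>q\<in>\<mm>. q \<otimes> u \<in> W)"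
      using I monomial_notin_nondivisor_ideal[of a] a(2) by (intro exI[of _ "nondivisor_ideal a"]) simp
  qed (use fE monomial_closed in auto)
  ultimately show ?thesis by simp
qed

text \<open>Exponents vanish outside \<open>D\<close>, so that each monomial of degree \<open>r\<close> is counted once.\<close>

definition exponents :: "nat \<Rightarrow> ('i \<Rightarrow> nat) set" where
  "exponents r = {a. (\<forall>i. i \<notin> D \<longrightarrow> a i = 0) \<and> (\<Sum>i\<in>D. a i) = r}"

lemma exponents_antichain:
  assumes "a \<in> exponents r" "b \<in> exponents r" "a \<noteq> b"
  shows "\<exists>k\<in>D. a k < b k"
proof (rule ccontr)
  assume "\<not> ?thesis"
  then have le: "\<And>k. k \<in> D \<Longrightarrow> b k \<le> a k" by (simp add: not_less)
  obtain j where j: "a j \<noteq> b j" using assms(3) by blast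
  then have "j \<in> D" using assms(1,2) unfolding exponents_def by (metis (mono_tags, lifting) mem_Collect_eq)
  then have "\<exists>i\<in>D. b i < a i" using le j by (metis order_less_le)
  then have "(\<Sum>i\<in>D. b i) < (\<Sum>i\<in>D. a i)" using fin le by (intro sum_strict_mono_ex1) auto
  then show False using assms(1,2) unfolding exponents_def by simp
qed

text \<open>Enumerating \<open>D\<close> turns exponents of degree \<open>r\<close> into lists of natural numbers with sum \<open>r\<close>.\<close>

lemma finite_card_exponents: "finite (exponents r)" "card (exponents r) = (card D + r - 1) choose r"
proof -
  define n where "n = card D"
  obtain h where h: "bij_betw h {0..<n} D" unfolding n_def using ex_bij_betw_nat_finite[OF fin] by blast
  define L where "L = {l::nat list. length l = n \<and> sum_list l = r}"
  define g where "g = inv_into {0..<n} h"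
  have g: "g (h i) = i" if "i < n" for i
    unfolding g_def using h that by (intro inv_into_f_f) (auto simp: bij_betw_def)
  have hD: "h i \<in> D" if "i < n" for i using h that by (auto simp: bij_betw_def)
  have himg: "h ` {0..<n} = D" using h by (rule bij_betw_imp_surj_on)
  have gD: "g i < n" "h (g i) = i" if "i \<in> D" for i
    using that inv_into_into[of i h "{0..<n}"] f_inv_into_f[of i h "{0..<n}"]
    unfolding g_def himg by simp_all
  have sum: "(\<Sum>i\<in>D. a i) = sum_list (map (\<lambda>i. a (h i)) [0..<n])" for a :: "'i \<Rightarrow> nat"
    using sum.reindex_bij_betw[OF h, of a] by (simp add: interv_sum_list_conv_sum_set_nat)
  have bij: "bij_betw (\<lambda>a. map (\<lambda>i. a (h i)) [0..<n]) (exponents r) L"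
  proof (rule bij_betwI[where g = "\<lambda>l i. if i \<in> D then l ! g i else 0"])
    show "(\<lambda>a. map (\<lambda>i. a (h i)) [0..<n]) \<in> exponents r \<rightarrow> L"
      unfolding exponents_def L_def by (auto simp: sum)
    show "(\<lambda>l i. if i \<in> D then l ! g i else 0) \<in> L \<rightarrow> exponents r"
    proof
      fix l assume "l \<in> L"
      then have l: "length l = n" "sum_list l = r" unfolding L_def by auto
      have "map (\<lambda>i. if h i \<in> D then l ! g (h i) else 0) [0..<n] = l"
        using l(1) g hD by (intro nth_equalityI) auto
      then show "(\<lambda>i. if i \<in> D then l ! g i else 0) \<in> exponents r"
        unfolding exponents_def by (simp add: sum l(2))
    qed
    fix a assume a: "a \<in> exponents r"
    show "(\<lambda>i. if i \<in> D then map (\<lambda>i. a (h i)) [0..<n] ! g i else 0) = a"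
      using a gD unfolding exponents_def by auto
  next
    fix l assume "l \<in> L"
    then show "map (\<lambda>i. if h i \<in> D then l ! g (h i) else 0) [0..<n] = l"
      using g hD unfolding L_def by (intro nth_equalityI) auto
  qed
  have "L \<subseteq> {l. set l \<subseteq> {..r} \<and> length l = n}"
    unfolding L_def using member_le_sum_list by auto
  then have "finite L" by (rule finite_subset) (simp add: finite_lists_length_eq)
  then show "finite (exponents r)" using bij_betw_finite[OF bij] by simp
  have "card (exponents r) = card L" by (rule bij_betw_same_card[OF bij])
  also have "\<dots> = (r + n - 1) choose r" unfolding L_def by (rule card_length_sum_list)
  finally show "card (exponents r) = (card D + r - 1) choose r" unfolding n_def by (simp add: add.commute)
qed

lemma monomial_in_power:
  assumes T: "T \<subseteq> D" and "\<And>i. i \<in> D - T \<Longrightarrow> a i = 0"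
  shows "monomial a \<in> Idl (z ` T) [^]\<^bsub>ideals_set R\<^esub> (\<Sum>i\<in>D. a i)"
  using assms(2)
proof (induction "\<Sum>i\<in>D. a i" arbitrary: a)
  case 0
  then have "(\<Sum>i\<in>D. a i) = 0" by simp
  then show ?case using monomial_closed by (simp only: nat_pow_def) (simp add: ideals_set_def)
next
  case (Suc n)
  then have "(\<Sum>i\<in>D. a i) \<noteq> 0" by simp
  then obtain k where k: "k \<in> D" "a k \<noteq> 0" using fin by auto
  then have kT: "k \<in> T" using Suc.prems[of k] by auto
  define b where "b = a(k := a k - 1)"
  have ab: "a = b(k := Suc (b k))" unfolding b_def using k(2) by auto
  have "(\<Sum>i\<in>D. a i) = a k + (\<Sum>i\<in>D - {k}. a i)" "(\<Sum>i\<in>D. b i) = b k + (\<Sum>i\<in>D - {k}. b i)"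
    using fin k(1) by (simp_all add: sum.remove)
  moreover have "(\<Sum>i\<in>D - {k}. b i) = (\<Sum>i\<in>D - {k}. a i)" unfolding b_def by simp
  ultimately have sb: "(\<Sum>i\<in>D. a i) = Suc (\<Sum>i\<in>D. b i)" using k(2) unfolding b_def by simp
  have "b i = 0" if "i \<in> D - T" for i using Suc.prems[OF that] kT that unfolding b_def by auto
  then have "monomial b \<in> Idl (z ` T) [^]\<^bsub>ideals_set R\<^esub> (\<Sum>i\<in>D. b i)" using Suc sb by simp
  moreover have "z k \<in> Idl (z ` T)" using genideal_self[OF zTc[OF T]] kT by blast
  ultimately have "monomial b \<otimes> z k \<in> Idl (z ` T) [^]\<^bsub>ideals_set R\<^esub> Suc (\<Sum>i\<in>D. b i)"
    unfolding ideal_prod_Suc_pow by (rule ideal_prod.prod)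
  moreover have "monomial a = monomial b \<otimes> z k"
    using monomial_update[OF k(1), of b] m_comm[OF monomial_closed zc[OF k(1)]] ab by simp
  ultimately show ?case unfolding sb by simp
qed

lemma power_m_eq: "\<mm> [^]\<^bsub>ideals_set R\<^esub> r = Idl (monomial ` exponents r)"
proof
  have mc: "monomial ` E \<subseteq> carrier R" for E using monomial_closed by auto
  show "\<mm> [^]\<^bsub>ideals_set R\<^esub> r \<subseteq> Idl (monomial ` exponents r)"
  proof (induction r)
    case 0
    have I: "ideal (Idl (monomial ` exponents 0)) R" by (rule genideal_ideal[OF mc])
    have "monomial (\<lambda>_. 0) = \<one>" unfolding monomial_def by simp
    then have "\<one> \<in> monomial ` exponents 0" unfolding exponents_def by force
    then have "\<one> \<in> Idl (monomial ` exponents 0)" using genideal_self[OF mc] by blast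
    then show ?case using ideal.one_imp_carrier[OF I] by (simp add: nat_pow_def ideals_set_def)
  next
    case (Suc r)
    define K where "K = Idl (monomial ` exponents (Suc r))"
    have K: "ideal K R" unfolding K_def by (rule genideal_ideal[OF mc])
    have gen1: "monomial a \<otimes> z k \<in> K" if "a \<in> exponents r" "k \<in> D" for a k
    proof -
      have "(\<Sum>i\<in>D. (a(k := Suc (a k))) i) = Suc (\<Sum>i\<in>D. a i)"
        using fin that(2) by (simp add: sum.remove)
      then have "a(k := Suc (a k)) \<in> exponents (Suc r)" using that unfolding exponents_def by auto
      then have "monomial (a(k := Suc (a k))) \<in> K" unfolding K_def using genideal_self[OF mc] by blast
      then show ?thesis
        using monomial_update[OF that(2)] m_comm[OF monomial_closed zc[OF that(2)]] by simp
    qed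
    have gen2: "monomial a \<otimes> j \<in> K" if a: "a \<in> exponents r" and j: "j \<in> \<mm>" for a j
    proof (rule mult_Idl_subset[OF K monomial_closed zTc[OF order_refl]])
      show "j \<in> Idl (z ` D)" using j gen by simp
      show "monomial a \<otimes> s \<in> K" if "s \<in> z ` D" for s using gen1[OF a] that by blast
    qed
    have gen3: "i \<otimes> j \<in> K" if i: "i \<in> Idl (monomial ` exponents r)" and j: "j \<in> \<mm>" for i j
    proof -
      have jc: "j \<in> carrier R" using ideal.Icarr[OF ideal_m j] .
      have "j \<otimes> i \<in> K"
      proof (rule mult_Idl_subset[OF K jc mc _ i])
        fix s assume "s \<in> monomial ` exponents r"
        then obtain a where a: "a \<in> exponents r" "s = monomial a" by blast
        then show "j \<otimes> s \<in> K" using gen2[OF a(1) j] m_comm[OF jc monomial_closed] by simp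
      qed
      then show ?thesis using m_comm[OF jc ideal.Icarr[OF genideal_ideal[OF mc] i]] by simp
    qed
    show ?case
    proof
      fix w assume "w \<in> \<mm> [^]\<^bsub>ideals_set R\<^esub> Suc r"
      then have "w \<in> (\<mm> [^]\<^bsub>ideals_set R\<^esub> r) \<cdot> \<mm>" unfolding ideal_prod_Suc_pow .
      then show "w \<in> Idl (monomial ` exponents (Suc r))"
        unfolding K_def[symmetric]
      proof (induction rule: ideal_prod.induct)
        case (prod i j)
        then show ?case using gen3 Suc.IH by blast
      next
        case (sum s1 s2)
        then show ?case using ideal_add[OF K] by blast
      qed
    qed
  qed
  have "monomial a \<in> \<mm> [^]\<^bsub>ideals_set R\<^esub> r" if "a \<in> exponents r" for a
    using monomial_in_power[OF order_refl, of a] that gen unfolding exponents_def by simp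
  then show "Idl (monomial ` exponents r) \<subseteq> \<mm> [^]\<^bsub>ideals_set R\<^esub> r"
    by (intro genideal_minimal ideal_pow ideal_m) auto
qed

lemma min_gens_power_m: "min_gens R (\<mm> [^]\<^bsub>ideals_set R\<^esub> r) = (card D + r - 1) choose r"
  unfolding power_m_eq
  using min_gens_monomials[OF finite_card_exponents(1) exponents_antichain] finite_card_exponents(2)
  by simp

end

section \<open>Monomial ideals that are stable with respect to one variable\<close>

lemma exists_smaller_exponent_of_sum:
  fixes b :: "'i \<Rightarrow> nat"
  assumes "finite T" "r \<le> (\<Sum>i\<in>T. b i)"
  shows "\<exists>a. (\<forall>i. a i \<le> b i) \<and> (\<forall>i. i \<notin> T \<longrightarrow> a i = 0) \<and> (\<Sum>i\<in>T. a i) = r"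
  using assms(2)
proof (induction r)
  case 0
  show ?case by (intro exI[of _ "\<lambda>_. 0"]) simp
next
  case (Suc r)
  then obtain a where a: "\<forall>i. a i \<le> b i" "\<forall>i. i \<notin> T \<longrightarrow> a i = 0" "(\<Sum>i\<in>T. a i) = r" by auto
  have "\<exists>i\<in>T. a i < b i"
  proof (rule ccontr)
    assume "\<not> ?thesis"
    then have "(\<Sum>i\<in>T. b i) \<le> (\<Sum>i\<in>T. a i)" by (intro sum_mono) (simp add: not_less)
    then show False using a(3) Suc.prems by simp
  qed
  then obtain i where i: "i \<in> T" "a i < b i" by blast
  have "(\<Sum>j\<in>T. (a(i := Suc (a i))) j) = Suc r"
    using assms(1) i(1) a(3) by (simp add: sum.remove)
  then show ?case using a i by (intro exI[of _ "a(i := Suc (a i))"]) auto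
qed

context regular_parameters
begin

lemma monomial_single: "p \<in> D \<Longrightarrow> monomial ((\<lambda>_. 0)(p := n)) = z p [^] n"
proof -
  assume p: "p \<in> D"
  have "(\<Otimes>i\<in>D - {p}. z i [^] ((\<lambda>_. 0)(p := n)) i) = (\<Otimes>i\<in>D - {p}. \<one>)"
    by (intro finprod_cong) auto
  then show ?thesis using monomial_split[OF p, of "(\<lambda>_. 0)(p := n)"] zc[OF p] by simp
qed

text \<open>Write \<open>x = z p\<close>, and for an exponent \<open>b\<close> in the other variables of degree at most \<open>r\<close> let \<open>h\<close> be
  minimal with \<open>x\<^sup>h z\<^sup>b\<close> in \<open>I\<close>. These monomials generate \<open>I\<close>, because \<open>I\<close> contains all monomials of
  degree \<open>r\<close> in the other variables. None of them divides another one: otherwise \<open>I\<close> would contain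
  some \<open>x\<^sup>h z\<^sup>b / z i\<close>; if \<open>h > 0\<close>, trading one \<open>x\<close> for \<open>z i\<close> contradicts the minimality of \<open>h\<close>, and
  if \<open>h = 0\<close>, its degree is below \<open>r\<close>, against \<open>ord\<close>. So the minimal generators correspond to the
  exponents \<open>b\<close> of degree at most \<open>r\<close>. Completing \<open>b\<close> by a power of \<open>x\<close> to degree exactly \<open>r\<close> matches
  them with the monomials of degree \<open>r\<close>; below, \<open>b\<close> is represented by its completion.\<close>

lemma min_gens_stable_monomial_ideal:
  assumes p: "p \<in> D" and I: "I = Idl (monomial ` A)"
    and stable: "\<And>a k. monomial a \<in> I \<Longrightarrow> 0 < a p \<Longrightarrow> k \<in> D - {p} \<Longrightarrow>
      monomial (a(p := a p - 1, k := Suc (a k))) \<in> I"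
    and top: "\<And>a. a \<in> exponents r \<Longrightarrow> a p = 0 \<Longrightarrow> monomial a \<in> I"
    and pure: "z p [^] (n::nat) \<in> I"
    and ord: "I \<subseteq> \<mm> [^]\<^bsub>ideals_set R\<^esub> r"
  shows "min_gens R I = (card D + r - 1) choose r"
proof -
  have mc: "monomial ` A' \<subseteq> carrier R" for A' using monomial_closed by auto
  have II: "ideal I R" unfolding I by (rule genideal_ideal[OF mc])
  define h where "h a = (LEAST n. monomial (a(p := n)) \<in> I)" for a
  define \<phi> where "\<phi> a = a(p := h a)" for a
  have \<phi>_p: "\<phi> a p = h a" and \<phi>_k: "k \<noteq> p \<Longrightarrow> \<phi> a k = a k" for a k unfolding \<phi>_def by simp_all
  have "monomial (a(p := n)) \<in> I" for a
    by (rule monomial_dvd[OF II, of "(\<lambda>_. 0)(p := n)"]) (use monomial_single[OF p, of n] pure in auto)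
  then have \<phi>I: "monomial (\<phi> a) \<in> I" for a
    unfolding \<phi>_def h_def by (rule LeastI)
  have h_le: "h a \<le> n" if "monomial (a(p := n)) \<in> I" for a n
    unfolding h_def using that by (rule Least_le)
  \<comment> \<open>the entry at \<open>p\<close> is determined by the others and the degree\<close>
  have off_p: "\<exists>i\<in>D - {p}. a' i < a i" if a: "a \<in> exponents r" "a' \<in> exponents r" "a \<noteq> a'"
    and le: "\<And>i. i \<in> D - {p} \<Longrightarrow> a' i \<le> a i" for a a'
  proof (rule ccontr)
    assume "\<not> ?thesis"
    then have eq: "\<And>i. i \<in> D - {p} \<Longrightarrow> a' i = a i" using le by (metis order_less_le)
    have "\<exists>k\<in>D. a k < a' k" "\<exists>k\<in>D. a' k < a k"
      using exponents_antichain[OF a] exponents_antichain[OF a(2,1)] a(3) by auto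
    then have "a p < a' p" "a' p < a p" using eq by (metis Diff_iff less_irrefl singletonD)+
    then show False by simp
  qed
  have anti: "\<exists>k\<in>D. \<phi> a k < \<phi> a' k" if a: "a \<in> exponents r" "a' \<in> exponents r" "a \<noteq> a'" for a a'
  proof (rule ccontr)
    assume "\<not> ?thesis"
    then have le: "\<And>k. k \<in> D \<Longrightarrow> \<phi> a' k \<le> \<phi> a k" by (simp add: not_less)
    have "\<And>i. i \<in> D - {p} \<Longrightarrow> a' i \<le> a i" using le \<phi>_k by fastforce
    then obtain i where i: "i \<in> D" "i \<noteq> p" "a' i < a i" using off_p[OF a] by blast
    define w where "w = (\<phi> a)(i := a i - 1)"
    have wI: "monomial w \<in> I"
    proof (rule monomial_dvd[OF II \<phi>I[of a']])
      fix k assume k: "k \<in> D"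
      show "\<phi> a' k \<le> w k" using le[OF k] i unfolding w_def by (auto simp: \<phi>_k)
    qed
    show False
    proof (cases "h a = 0")
      case False
      have wp: "w p = h a" using i(2) unfolding w_def by (simp add: \<phi>_p)
      have "monomial (w(p := w p - 1, i := Suc (w i))) \<in> I"
        using stable[OF wI] False wp i by simp
      moreover have "w(p := w p - 1, i := Suc (w i)) = a(p := h a - 1)"
        unfolding wp using i unfolding w_def \<phi>_def by (auto simp: fun_eq_iff)
      ultimately have "h a \<le> h a - 1" using h_le[of a "h a - 1"] by simp
      then show False using False by simp
    next
      case True
      have "monomial w \<in> Idl (monomial ` exponents r)" using wI ord power_m_eq by blast
      then obtain v where v: "v \<in> exponents r" "\<And>k. k \<in> D \<Longrightarrow> v k \<le> w k"
        using monomial_mem_Idl_monomials by blast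
      have wa: "w k \<le> a k" for k using True i unfolding w_def \<phi>_def by auto
      have "w i < a i" unfolding w_def using i by simp
      then have "(\<Sum>k\<in>D. w k) < (\<Sum>k\<in>D. a k)"
        using fin wa i(1) by (intro sum_strict_mono_ex1) auto
      moreover have "(\<Sum>k\<in>D. v k) \<le> (\<Sum>k\<in>D. w k)" using v(2) by (rule sum_mono)
      ultimately show False using a(1) v(1) unfolding exponents_def by simp
    qed
  qed
  then have inj: "inj_on \<phi> (exponents r)" by (metis inj_onI less_irrefl)
  have below: "\<exists>a\<in>exponents r. \<forall>k\<in>D. \<phi> a k \<le> b k" if b: "monomial b \<in> I" for b
  proof (cases "(\<Sum>i\<in>D - {p}. b i) \<le> r")
    case True
    define a where "a i = (if i \<notin> D then 0 else if i = p then r - (\<Sum>i\<in>D - {p}. b i) else b i)" for i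
    have "(\<Sum>i\<in>D - {p}. a i) = (\<Sum>i\<in>D - {p}. b i)" unfolding a_def by (rule sum.cong) auto
    then have "(\<Sum>i\<in>D. a i) = r" using True p fin by (simp add: sum.remove[OF fin p, of a]) (simp add: a_def p)
    then have aE: "a \<in> exponents r" unfolding exponents_def by (simp add: a_def)
    have "monomial (a(p := b p)) = monomial b" by (rule monomial_cong) (simp add: a_def)
    then have "h a \<le> b p" using b by (intro h_le) simp
    then have "\<forall>k\<in>D. \<phi> a k \<le> b k" unfolding \<phi>_def by (auto simp: a_def)
    then show ?thesis using aE by blast
  next
    case False
    then obtain a where a: "\<forall>i. a i \<le> b i" "\<forall>i. i \<notin> D - {p} \<longrightarrow> a i = 0" "(\<Sum>i\<in>D - {p}. a i) = r"
      using exists_smaller_exponent_of_sum[of "D - {p}" r b] fin by auto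
    have ap: "a p = 0" using a(2) by simp
    have aE: "a \<in> exponents r"
      unfolding exponents_def using a sum.remove[OF fin p, of a] ap by simp
    have "a(p := 0) = a" using ap by auto
    then have "h a \<le> 0" using top[OF aE ap] by (intro h_le) simp
    then have "\<forall>k\<in>D. \<phi> a k \<le> b k" unfolding \<phi>_def using a(1) by simp
    then show ?thesis using aE by blast
  qed
  define E where "E = \<phi> ` exponents r"
  have "I = Idl (monomial ` E)"
  proof
    have "monomial ` E \<subseteq> I" unfolding E_def using \<phi>I by auto
    then show "Idl (monomial ` E) \<subseteq> I" by (rule genideal_minimal[OF II])
    have "monomial b \<in> Idl (monomial ` E)" if "b \<in> A" for b
    proof -
      have "monomial b \<in> I" unfolding I using genideal_self[OF mc] that by blast
      then obtain a where a: "a \<in> exponents r" "\<And>k. k \<in> D \<Longrightarrow> \<phi> a k \<le> b k" using below by blast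
      have "monomial (\<phi> a) \<in> Idl (monomial ` E)"
        using genideal_self[OF mc, of E] a(1) unfolding E_def by blast
      then show ?thesis using a(2) by (rule monomial_dvd[OF genideal_ideal[OF mc]])
    qed
    then have "monomial ` A \<subseteq> Idl (monomial ` E)" by blast
    then show "I \<subseteq> Idl (monomial ` E)"
      unfolding I by (rule genideal_minimal[OF genideal_ideal[OF mc]])
  qed
  moreover have "min_gens R (Idl (monomial ` E)) = card E"
  proof (rule min_gens_monomials)
    show "finite E" unfolding E_def using finite_card_exponents(1) by (rule finite_imageI)
    fix e e' assume "e \<in> E" "e' \<in> E" "e \<noteq> e'"
    then show "\<exists>k\<in>D. e k < e' k" unfolding E_def using anti by auto
  qed
  moreover have "card E = (card D + r - 1) choose r"
    unfolding E_def using card_image[OF inj] finite_card_exponents(2) by simp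
  ultimately show ?thesis by simp
qed

lemma parameter_regular: "k \<in> D \<Longrightarrow> z k \<in> nonzerodivisors R"
proof -
  assume k: "k \<in> D"
  have "Idl {} = {\<zero>}"
    using genideal_minimal[OF zeroideal, of "{}"] ideal_zero[OF genideal_ideal[of "{}"]] by auto
  then have pr: "primeideal {\<zero>} R" and nz: "z k \<noteq> \<zero>"
    using prime_Idl_subset[of "{}"] parameter_notin_Idl[of "{}" k] k by simp_all
  have "a = \<zero>" if "a \<in> carrier R" "z k \<otimes> a = \<zero>" for a
    using primeideal.I_prime[OF pr zc[OF k] that(1)] that(2) nz by simp
  then show ?thesis unfolding nonzerodivisors_def using zc[OF k] by simp
qed

end

section \<open>Contraction from the blowup chart\<close>

text \<open>In the chart \<open>y k = x (y k / x)\<close>, so a factor \<open>x\<close> of an element of \<open>I\<close> may be traded for \<open>y k\<close>.\<close>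

lemma (in fraction_ring) contracted_shift:
  assumes contr: "contracted_from R (blowup_chart R K \<iota> d x y) \<iota> I"
    and x: "x \<in> nonzerodivisors R" and k: "k \<in> {2..d}" "y k \<in> carrier R"
    and w: "w \<in> carrier R" "x \<otimes> w \<in> I"
  shows "y k \<otimes> w \<in> I"
proof -
  let ?S = "blowup_chart R K \<iota> d x y"
  have xc: "x \<in> carrier R" using x unfolding nonzerodivisors_def by blast
  have xu: "\<iota> x \<in> Units K" using units[OF x] .
  define g where "g = \<iota> (y k) \<otimes>\<^bsub>K\<^esub> inv\<^bsub>K\<^esub> (\<iota> x)"
  have gS: "g \<in> carrier ?S"
    unfolding g_def blowup_chart_def using k(1) by (auto intro!: generate_ring.incl)
  have mult: "a \<otimes>\<^bsub>?S\<^esub> b = a \<otimes>\<^bsub>K\<^esub> b" for a b unfolding blowup_chart_def by simp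
  have c: "\<iota> w \<in> carrier K" "\<iota> (y k) \<in> carrier K" "\<iota> x \<in> carrier K" "inv\<^bsub>K\<^esub> (\<iota> x) \<in> carrier K"
    using w(1) k(2) xc xu by (simp_all add: S.Units_inv_closed)
  have "\<iota> (x \<otimes> w) \<otimes>\<^bsub>K\<^esub> g = (\<iota> x \<otimes>\<^bsub>K\<^esub> inv\<^bsub>K\<^esub> (\<iota> x)) \<otimes>\<^bsub>K\<^esub> (\<iota> (y k) \<otimes>\<^bsub>K\<^esub> \<iota> w)"
    unfolding g_def using c w(1) xc by (simp add: S.m_ac)
  also have "\<dots> = \<iota> (y k \<otimes> w)" using c w(1) k(2) xu by (simp add: S.Units_r_inv)
  finally have eq: "\<iota> (y k \<otimes> w) = \<iota> (x \<otimes> w) \<otimes>\<^bsub>?S\<^esub> g" unfolding mult by simp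
  have "\<iota> (y k \<otimes> w) \<in> genideal ?S (\<iota> ` I)"
    unfolding genideal_def
  proof (rule InterI)
    fix J assume "J \<in> {J. ideal J ?S \<and> \<iota> ` I \<subseteq> J}"
    then have J: "ideal J ?S" "\<iota> (x \<otimes> w) \<in> J" using w(2) by auto
    show "\<iota> (y k \<otimes> w) \<in> J" unfolding eq using ideal.I_r_closed[OF J gS] .
  qed
  then have "y k \<otimes> w \<in> {a \<in> carrier R. \<iota> a \<in> genideal ?S (\<iota> ` I)}" using w(1) k(2) by simp
  also have "\<dots> = I" using contr unfolding contracted_from_def .
  finally show ?thesis .
qed

text \<open>A finite supremum of chain lengths is attained, and the last prime of a longest chain may be
  replaced by the maximal ideal.\<close>

lemma (in noetherian_local_ring) krull_dim_chain:
  assumes "krull_dim R = enat d"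
  shows "\<exists>P. prime_chain R P d \<and> P d = \<mm>"
proof -
  define N where "N = {enat n | n. \<exists>P. prime_chain R P n}"
  have sup: "Sup N = enat d"
    using assms unfolding krull_dim_def N_def prime_chain_def by simp
  have "enat d \<in> N"
  proof (rule ccontr)
    assume no: "enat d \<notin> N"
    have lt: "n < enat d" if "n \<in> N" for n
      using Sup_upper[OF that] that no unfolding sup by (metis order_less_le)
    have "prime_chain R (\<lambda>_. \<mm>) 0" using prime_m unfolding prime_chain_def by simp
    then have "enat 0 \<in> N" unfolding N_def by blast
    then have "d > 0" using lt by fastforce
    have "n \<le> enat (d - 1)" if "n \<in> N" for n
      using lt[OF that] by (cases n) auto
    then have "Sup N \<le> enat (d - 1)" by (rule Sup_least)
    then show False unfolding sup using \<open>d > 0\<close> by simp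
  qed
  then obtain P where P: "prime_chain R P d" unfolding N_def by auto
  then have "primeideal (P d) R" unfolding prime_chain_def by simp
  then have "P d \<subseteq> \<mm>"
    using proper_ideal_subset_m primeideal.axioms(1) primeideal.I_notcarr by metis
  then have "prime_chain R (P(d := \<mm>)) d"
    using P prime_m unfolding prime_chain_def by (auto simp: less_Suc_eq)
  then show ?thesis by (intro exI[of _ "P(d := \<mm>)"]) simp
qed

theorem theorem4p10:
  fixes R :: "('a, 'm) ring_scheme" and K :: "('b, 'n) ring_scheme" and \<iota> :: "'a \<Rightarrow> 'b"
    and \<mm> I :: "'a set" and d r :: nat and x :: 'a and y :: "nat \<Rightarrow> 'a"
  assumes "regular_local_ring R \<mm>"
    and "equicharacteristic R \<mm>"
    and "krull_dim R = enat d"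
    and "1 \<le> d"
    and "x \<in> carrier R" and "\<And>i. i \<in> {2..d} \<Longrightarrow> y i \<in> carrier R"
    and "\<mm> = genideal R (insert x (y ` {2..d}))"
    and "fraction_ring R K \<iota>"
    and "primary_ideal I R" and "ideal_radical R I = \<mm>"
    and "monomial_ideal R d x y I"
    and "I \<subseteq> \<mm> [^]\<^bsub>ideals_set R\<^esub> r" and "\<not> I \<subseteq> \<mm> [^]\<^bsub>ideals_set R\<^esub> Suc r"
    and "genideal R (y ` {2..d}) [^]\<^bsub>ideals_set R\<^esub> r \<subseteq> I"
    and "contracted_from R (blowup_chart R K \<iota> d x y) \<iota> I"
  shows "min_gens R I = min_gens R (\<mm> [^]\<^bsub>ideals_set R\<^esub> r) \<and>
         min_gens R (\<mm> [^]\<^bsub>ideals_set R\<^esub> r) = (d + r - 1) choose r"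
proof -
  interpret regular_local_ring R \<mm> by fact
  define z where "z i = (if i = 1 then x else y i)" for i
  have D: "{1..d} = insert 1 {2..d}" using assms(4) by auto
  have D2: "{1..d} - {1} = {2..d}" by auto
  have zy: "z ` {2..d} = y ` {2..d}" unfolding z_def by (rule image_cong) auto
  interpret regular_parameters R \<mm> z "{1..d}"
  proof
    show "z i \<in> carrier R" if "i \<in> {1..d}" for i using that assms(5,6) unfolding z_def by auto
    have "z ` {1..d} = insert x (y ` {2..d})" unfolding D image_insert zy by (simp add: z_def)
    then show "\<mm> = genideal R (z ` {1..d})" using assms(7) by simp
    show "\<exists>P. prime_chain R P (card {1..d}) \<and> P (card {1..d}) = \<mm>"
      using krull_dim_chain[OF assms(3)] by simp
  qed simp
  have one: "1 \<in> {1..d}" using assms(4) by simp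
  have mono: "x [^]\<^bsub>R\<^esub> a \<otimes>\<^bsub>R\<^esub> finprod R (\<lambda>i. y i [^]\<^bsub>R\<^esub> b i) {2..d} = monomial (\<lambda>i. if i = 1 then a else b i)"
    for a :: nat and b
  proof -
    have "finprod R (\<lambda>i. z i [^]\<^bsub>R\<^esub> (if i = 1 then a else b i)) {2..d} = finprod R (\<lambda>i. y i [^]\<^bsub>R\<^esub> b i) {2..d}"
      using assms(6) by (intro finprod_cong) (auto simp: z_def)
    then show ?thesis using monomial_split[OF one, of "\<lambda>i. if i = 1 then a else b i"]
      unfolding D2 by (simp add: z_def)
  qed
  obtain G where G: "G \<subseteq> monomials R d x y" "I = genideal R G"
    using assms(11) unfolding monomial_ideal_def by blast
  have "monomials R d x y \<subseteq> range monomial" unfolding monomials_def mono by blast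
  then obtain A where A: "G = monomial ` A" using G(1) by (meson order_trans subset_imageE)
  have x: "x \<in> nonzerodivisors R" using parameter_regular[OF one] by (simp add: z_def)
  have "x \<in> \<mm>" using z_mem_m[OF one] by (simp add: z_def)
  then obtain n :: nat where n: "x [^]\<^bsub>R\<^esub> n \<in> I" using assms(10) unfolding ideal_radical_def by blast
  have "min_gens R I = (card {1..d} + r - 1) choose r"
  proof (rule min_gens_stable_monomial_ideal[OF one])
    show "I = genideal R (monomial ` A)" using G(2) A by simp
    show "z 1 [^]\<^bsub>R\<^esub> n \<in> I" using n by (simp add: z_def)
    show "I \<subseteq> \<mm> [^]\<^bsub>ideals_set R\<^esub> r" by fact
    show "monomial a \<in> I" if "a \<in> exponents r" "a 1 = 0" for a
    proof -
      have "monomial a \<in> genideal R (z ` {2..d}) [^]\<^bsub>ideals_set R\<^esub> (\<Sum>i\<in>{1..d}. a i)"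
      proof (rule monomial_in_power)
        show "{2..d} \<subseteq> {1..d}" by auto
        fix i assume "i \<in> {1..d} - {2..d}"
        then have "i = 1" by auto
        then show "a i = 0" using that(2) by simp
      qed
      moreover have "(\<Sum>i\<in>{1..d}. a i) = r" using that(1) unfolding exponents_def by simp
      ultimately show ?thesis using assms(14) unfolding zy by auto
    qed
    fix a k assume a: "monomial a \<in> I" "0 < a 1" and k: "k \<in> {1..d} - {1}"
    define b where "b = a(1 := a 1 - 1)"
    have ab: "a = b(1 := Suc (b 1))" unfolding b_def using a(2) by auto
    have "x \<otimes>\<^bsub>R\<^esub> monomial b \<in> I"
      using a(1) monomial_update[OF one, of b] ab by (simp add: z_def)
    then have "y k \<otimes>\<^bsub>R\<^esub> monomial b \<in> I"
      using fraction_ring.contracted_shift[OF assms(8,15) x _ _ monomial_closed] k assms(6)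
      unfolding D2 by blast
    moreover have "y k \<otimes>\<^bsub>R\<^esub> monomial b = monomial (b(k := Suc (b k)))"
      using monomial_update[of k b] k by (simp add: z_def)
    ultimately show "monomial (a(1 := a 1 - 1, k := Suc (a k))) \<in> I"
      using k unfolding b_def by simp
  qed
  then show ?thesis using min_gens_power_m[of r] by simp
qed

end
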